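(* Let $I=[0,1]$ and $T>0$, and assume that $\mathbf a$, $\mathbf s$, $x^0$, $m^0$ satisfy the following hypotheses. (H1) $\mathbf a:\mathbb R\to\mathbb R$ is Lipschitz with $\mathrm{Lip}(\mathbf a)=L$, and $\mathbf a(0)=0$. (H2) $m^0\in L^\infty(I)$, $\int_I m^0(s)\,ds=1$, and $\frac1M\le m^0\le M$ for some $M>1$; $x^0\in C(I)$ is a real-valued one-to-one function with $|x^0|\le X$ for some $X>0$. (H3) $\mathbf s:\mathbb R\to\mathbb R$ is odd, there is $\mathbf S_\infty>0$ with $|\mathbf s(x)|\le \mathbf S_\infty$ for all $x\in\mathbb R$, and there is $\mathbf S>0$ such that $|\mathbf s(x_1)-\mathbf s(x_2)|\le \mathbf S|x_1-x_2|$ whenever $x_1,x_2\in(0,\infty)$ and whenever $x_1,x_2\in(-\infty,0)$. Let $(x,m)\in C^1([0,T];C(I))\oplus C^1([0,T];L^\infty(I))$ be the solution of the graph limit equation $$\partial_t x(t,s)=\int_I m(t,s_\ast)\,\mathbf a(x(t,s_\ast)-x(t,s))\,ds_\ast,\quad \partial_t m(t,s)=\Psi(s,x(t,\cdot),m(t,\cdot)),\quad x(0,\cdot)=x^0,\ m(0,\cdot)=m^0.$$ For each $N\ge1$ let $(\mathbf x_N,\mathbf m_N)=(x_1,\dots,x_N,m_1,\dots,m_N)\in C^1([0,T];\mathbb R^{2N})$ be the solution of the $N$-opinion system defined in the context, and let $\widetilde x_N,\widetilde m_N$ be the associated step functions defined in the context. Then $$\|\widetilde x_N-x\|_{C([0,T];L^2(I))}+\|\widetilde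 m_N-m\|_{C([0,T];L^2(I))}\longrightarrow 0\quad\text{as }N\to\infty.$$
   Context: For functions $x,m$ on $I=[0,1]$ and $s\in I$, the functional $\Psi$ is $$\Psi(s,x(\cdot),m(\cdot)):=m(s)\iint_{I^2}m(s_\ast)m(s_{\ast\ast})\big(\mathbf a(x(s_{\ast\ast})-x(s))+\mathbf a(x(s_{\ast\ast})-x(s_\ast))\big)\,\mathbf s(x(s)-x(s_\ast))\,ds_\ast\,ds_{\ast\ast}.$$ The $N$-opinion system is: for $i=1,\dots,N$, $$\dot x_i(t)=\frac1N\sum_{j=1}^N m_j(t)\,\mathbf a(x_j(t)-x_i(t)),\qquad \dot m_i(t)=\psi_i^N(\mathbf x_N(t),\mathbf m_N(t)),$$ with initial data $$x_i(0)=N\int_{(i-1)/N}^{i/N}x^0(s)\,ds,\qquad m_i(0)=N\int_{(i-1)/N}^{i/N}m^0(s)\,ds.$$ The step functions are $$\widetilde x_N(t,s):=\sum_{i=1}^N x_i(t)\mathbf 1_{[\frac{i-1}N,\frac iN]}(s),\qquad \widetilde m_N(t,s):=\sum_{i=1}^N m_i(t)\mathbf 1_{[\frac{i-1}N,\frac iN]}(s)$$ (values at the finitely many grid points $i/N$ are irrelevant), and $$\psi_i^N(\mathbf x_N,\mathbf m_N):=N\int_{(i-1)/N}^{i/N}\Psi(s,\widetilde x_N,\widetilde m_N)\,ds=\frac1{N^2}m_i\sum_{j,k=1}^N m_jm_k\big(\mathbf a(x_k-x_i)+\mathbf a(x_k-x_j)\big)\mathbf s(x_i-x_j).$$ *)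

theory Defs
  imports "HOL-Probability.Probability" "HOL-Probability.Essential_Supremum"
begin

abbreviation unit_ivl :: "real set" (\<open>\<I>\<close>)
  where "\<I> \<equiv> {0..1}"

abbreviation leb_I :: "real measure" (\<open>\<lambda>\<^sub>I\<close>)
  where "\<lambda>\<^sub>I \<equiv> lebesgue_on \<I>"

definition Lip :: "(real \<Rightarrow> real) \<Rightarrow> real"
  where "Lip f = Inf {C. C-lipschitz_on UNIV f}"

text \<open>
  Elements of \<open>C(I)\<close>, \<open>L\<^sup>\<infinity>(I)\<close> and \<open>L\<^sup>2(I)\<close> are represented by functions on the
  real line whose values outside \<open>I\<close> are irrelevant; for the Lebesgue spaces they are
  representatives of classes modulo null sets.  The norms take values in the extended reals, so
  that a function outside the space has norm \<open>\<infinity>\<close> instead of a default value.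
\<close>

definition C_space :: "(real \<Rightarrow> real) set"
  where "C_space = {f. continuous_on \<I> f}"

definition C_norm :: "(real \<Rightarrow> real) \<Rightarrow> ereal"
  where "C_norm f = (SUP s\<in>\<I>. ereal \<bar>f s\<bar>)"

definition Linf_norm :: "(real \<Rightarrow> real) \<Rightarrow> ereal"
  where "Linf_norm f = esssup \<lambda>\<^sub>I (\<lambda>s. ereal \<bar>f s\<bar>)"

definition Linf_space :: "(real \<Rightarrow> real) set"
  where "Linf_space = {f \<in> borel_measurable \<lambda>\<^sub>I. Linf_norm f < \<infinity>}"

definition L2_norm :: "(real \<Rightarrow> real) \<Rightarrow> ereal"
  where "L2_norm f =
    (if f \<in> borel_measurable \<lambda>\<^sub>I \<and> integrable \<lambda>\<^sub>I (\<lambda>s. (f s)\<^sup>2)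
     then ereal (sqrt (LINT s|\<lambda>\<^sub>I. (f s)\<^sup>2)) else \<infinity>)"

definition C_L2_norm :: "real \<Rightarrow> (real \<Rightarrow> real \<Rightarrow> real) \<Rightarrow> ereal"
  where "C_L2_norm T u = (SUP t\<in>{0..T}. L2_norm (u t))"

text \<open>
  The curve \<open>t \<mapsto> u t\<close> belongs to \<open>C\<^sup>1([0,T]; V)\<close>, where \<open>V\<close> carries the norm \<open>nrm\<close>, and
  \<open>u'\<close> (an element of \<open>V\<close> for each time) is its derivative.  Difference quotients converge in
  the norm of \<open>V\<close>, one-sidedly at the end points.
\<close>

definition has_C1_derivative ::
    "(real \<Rightarrow> real) set \<Rightarrow> ((real \<Rightarrow> real) \<Rightarrow> ereal) \<Rightarrow> real \<Rightarrow>
     (real \<Rightarrow> real \<Rightarrow> real) \<Rightarrow> (real \<Rightarrow> real \<Rightarrow> real) \<Rightarrow> bool"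
  where "has_C1_derivative V nrm T u u' \<longleftrightarrow>
    (\<forall>t\<in>{0..T}.
       u t \<in> V \<and> u' t \<in> V \<and>
       ((\<lambda>\<tau>. nrm (\<lambda>s. (u \<tau> s - u t s) / (\<tau> - t) - u' t s)) \<longlongrightarrow> 0) (at t within {0..T}) \<and>
       ((\<lambda>\<tau>. nrm (\<lambda>s. u' \<tau> s - u' t s)) \<longlongrightarrow> 0) (at t within {0..T}))"

text \<open>
  Throughout, \<open>a\<close> is the interaction function and \<open>\<sigma>\<close> is the function that the
  mathematical source writes as a bold letter s.
\<close>

definition Psi ::
    "(real \<Rightarrow> real) \<Rightarrow> (real \<Rightarrow> real) \<Rightarrow> real \<Rightarrow> (real \<Rightarrow> real) \<Rightarrow> (real \<Rightarrow> real) \<Rightarrow> real"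
  where "Psi a \<sigma> s x m =
    m s * (LINT (s1, s2)|(\<lambda>\<^sub>I \<Otimes>\<^sub>M \<lambda>\<^sub>I).
      m s1 * m s2 * (a (x s2 - x s) + a (x s2 - x s1)) * \<sigma> (x s - x s1))"

text \<open>
  The equation for \<open>x\<close> is an identity in \<open>C(I)\<close>, the one for \<open>m\<close> an identity in
  \<open>L\<^sup>\<infinity>(I)\<close>; accordingly the initial condition for \<open>m\<close> holds almost everywhere.
\<close>

definition graph_limit_solution ::
    "(real \<Rightarrow> real) \<Rightarrow> (real \<Rightarrow> real) \<Rightarrow> (real \<Rightarrow> real) \<Rightarrow> (real \<Rightarrow> real) \<Rightarrow> real \<Rightarrow>
     (real \<Rightarrow> real \<Rightarrow> real) \<Rightarrow> (real \<Rightarrow> real \<Rightarrow> real) \<Rightarrow> bool"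
  where "graph_limit_solution a \<sigma> x0 m0 T x m \<longleftrightarrow>
    has_C1_derivative C_space C_norm T x
      (\<lambda>t s. LINT s'|\<lambda>\<^sub>I. m t s' * a (x t s' - x t s)) \<and>
    has_C1_derivative Linf_space Linf_norm T m (\<lambda>t s. Psi a \<sigma> s (x t) (m t)) \<and>
    (\<forall>s\<in>\<I>. x 0 s = x0 s) \<and>
    (AE s in \<lambda>\<^sub>I. m 0 s = m0 s)"

definition cell :: "nat \<Rightarrow> nat \<Rightarrow> real set"
  where "cell N i = {(real i - 1) / real N .. real i / real N}"

definition step_fun :: "nat \<Rightarrow> (nat \<Rightarrow> real) \<Rightarrow> real \<Rightarrow> real"
  where "step_fun N v s = (\<Sum>i=1..N. v i * indicator (cell N i) s)"

definition cell_avg :: "nat \<Rightarrow> nat \<Rightarrow> (real \<Rightarrow> real) \<Rightarrow> real"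
  where "cell_avg N i f = real N * (LINT s|lebesgue_on (cell N i). f s)"

definition psi_N ::
    "(real \<Rightarrow> real) \<Rightarrow> (real \<Rightarrow> real) \<Rightarrow> nat \<Rightarrow> nat \<Rightarrow> (nat \<Rightarrow> real) \<Rightarrow> (nat \<Rightarrow> real) \<Rightarrow> real"
  where "psi_N a \<sigma> N i xs ms =
    cell_avg N i (\<lambda>s. Psi a \<sigma> s (step_fun N xs) (step_fun N ms))"

text \<open>
  Vectors in \<open>N\<close>-dimensional space are functions on the naturals of which only the values at
  \<open>1, \<dots>, N\<close> matter.
\<close>

definition opinion_system_solution ::
    "(real \<Rightarrow> real) \<Rightarrow> (real \<Rightarrow> real) \<Rightarrow> (real \<Rightarrow> real) \<Rightarrow> (real \<Rightarrow> real) \<Rightarrow> real \<Rightarrow> nat \<Rightarrow>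
     (real \<Rightarrow> nat \<Rightarrow> real) \<Rightarrow> (real \<Rightarrow> nat \<Rightarrow> real) \<Rightarrow> bool"
  where "opinion_system_solution a \<sigma> x0 m0 T N xs ms \<longleftrightarrow>
    (\<forall>i\<in>{1..N}.
       (let dx = (\<lambda>t. (\<Sum>j=1..N. ms t j * a (xs t j - xs t i)) / real N);
            dm = (\<lambda>t. psi_N a \<sigma> N i (xs t) (ms t))
        in continuous_on {0..T} dx \<and> continuous_on {0..T} dm \<and>
           (\<forall>t\<in>{0..T}.
              ((\<lambda>\<tau>. xs \<tau> i) has_real_derivative dx t) (at t within {0..T}) \<and>
              ((\<lambda>\<tau>. ms \<tau> i) has_real_derivative dm t) (at t within {0..T}))) \<and>
       xs 0 i = cell_avg N i x0 \<and>
       ms 0 i = cell_avg N i m0)"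

end

theory Submission
  imports Defs "HOL-Real_Asymp.Real_Asymp"
begin

text \<open>
  Up to a null set, the step functions of the \<open>N\<close>-opinion system solve the same equation as the
  limit: only the initial data differ, and cell averages converge in \<open>L\<^sup>2\<close>.  So it suffices to
  close a Gronwall estimate for the squared \<open>L\<^sup>2\<close> distance.  Two obstacles remain.

  The function \<open>\<sigma>\<close> may jump at 0.  But \<open>x0\<close> is strictly monotone and both dynamics preserve the
  order of opinions, so for \<open>s\<close>, \<open>s'\<close> in different cells the arguments of \<open>\<sigma>\<close> have the same nonzero
  sign and the Lipschitz bound applies; pairs in the same cell contribute \<open>O(1/N)\<close>.

  The right-hand side is cubic in the weights.  Since \<open>\<sigma>\<close> is odd, the total mass is conserved, and
  the weights stay positive; this bounds the opinion spread and then each weight uniformly in \<open>N\<close>.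
\<close>

section \<open>Linear differential inequalities\<close>

text \<open>The a priori bounds have to come in a fixed order. The constants for the drift and for
  the growth of the weights contain the mean absolute weight, and conservation of mass controls that
  mean only once the weights are known to be positive. So positivity comes first, with a constant
  that may depend on \<open>N\<close> and on the solution, since only a sign is wanted. Then the
  mean absolute weight equals 1, and all later constants are free of \<open>N\<close>. For the limit
  weights a shorter way is open: a C1 curve in the essential supremum norm is bounded on the compact
  time interval, and that bound takes the place of the mass.

  The distance is an L2 distance because \<open>m0\<close> may be discontinuous, so its cell
  averages need not converge uniformly. Both limit curves are differentiable in stronger norms,
  which makes the squared distance differentiable in time.

  Step functions are written as \<open>v (idx N s)\<close>. This agrees with \<open>step_fun\<close>
  off the grid points, takes a single value at every point of \<open>\<I>\<close>, and turns
  integrals into averages over the components.\<close>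

lemma nonneg_deriv_within_imp_le:
  fixes f :: "real \<Rightarrow> real"
  assumes f: "\<And>\<tau>. \<tau> \<in> {0..T} \<Longrightarrow> (f has_real_derivative f' \<tau>) (at \<tau> within {0..T})"
    and nonneg: "\<And>\<tau>. \<tau> \<in> {0..T} \<Longrightarrow> 0 \<le> f' \<tau>" and t: "t \<in> {0..T}"
  shows "f 0 \<le> f t"
proof (cases "t = 0")
  case False
  with t have "0 < t" by simp
  have "(f has_derivative (\<lambda>h. f' \<tau> * h)) (at \<tau> within {0..t})" if "0 \<le> \<tau>" "\<tau> \<le> t" for \<tau>
    using DERIV_subset[OF f, of \<tau> "{0..t}"] that t by (auto simp: has_field_derivative_def)
  from mvt_simple[OF \<open>0 < t\<close> this] obtain \<tau> where "\<tau> \<in> {0<..<t}" "f t - f 0 = f' \<tau> * (t - 0)"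
    by auto
  moreover have "0 \<le> f' \<tau> * t"
    using \<open>\<tau> \<in> {0<..<t}\<close> t nonneg[of \<tau>] by auto
  ultimately show ?thesis by simp
qed simp

text \<open>The factor \<open>exp (- (C * \<tau>))\<close> absorbs the linear term. Bounding it by 1
  next to \<open>b\<close> gives \<open>b * t\<close> in place of the sharp quotient with
  \<open>C\<close> in the denominator, so \<open>C = 0\<close> is no special case.\<close>

lemma gronwall_affine:
  fixes f :: "real \<Rightarrow> real"
  assumes f: "\<And>\<tau>. \<tau> \<in> {0..T} \<Longrightarrow> (f has_real_derivative f' \<tau>) (at \<tau> within {0..T})"
    and le: "\<And>\<tau>. \<tau> \<in> {0..T} \<Longrightarrow> f' \<tau> \<le> C * f \<tau> + b" and C: "0 \<le> C" "0 \<le> b" and t: "t \<in> {0..T}"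
  shows "f t \<le> (f 0 + b * t) * exp (C * t)"
proof -
  let ?g = "\<lambda>\<tau>. b * \<tau> - f \<tau> * exp (- (C * \<tau>))"
  have "?g 0 \<le> ?g t"
  proof (rule nonneg_deriv_within_imp_le[where T = T])
    fix \<tau> assume \<tau>: "\<tau> \<in> {0..T}"
    show "(?g has_real_derivative (b + (C * f \<tau> - f' \<tau>) * exp (- (C * \<tau>)))) (at \<tau> within {0..T})"
      using f[OF \<tau>] by (auto intro!: derivative_eq_intros simp: algebra_simps)
    have "(f' \<tau> - C * f \<tau>) * exp (- (C * \<tau>)) \<le> b * exp (- (C * \<tau>))"
      using le[OF \<tau>] by (intro mult_right_mono) auto
    also have "\<dots> \<le> b * 1"
      using C \<tau> by (intro mult_left_mono) auto
    finally show "0 \<le> b + (C * f \<tau> - f' \<tau>) * exp (- (C * \<tau>))"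
      by (simp add: algebra_simps)
  qed fact
  then have "f t * exp (- (C * t)) \<le> f 0 + b * t" by simp
  then have "f t * exp (- (C * t)) * exp (C * t) \<le> (f 0 + b * t) * exp (C * t)"
    by (intro mult_right_mono) auto
  then show ?thesis by (simp add: mult.assoc flip: exp_add)
qed

text \<open>Squaring avoids the kink of the absolute value: \<open>(u \<tau>)\<^sup>2\<close> times
  the exponential of plus or minus \<open>2 * K * \<tau>\<close> is monotone. One sign gives the
  growth bound, the other keeps a nonzero \<open>u\<close> away from 0, so that it cannot change
  sign. Positivity of weights, conservation of mass and preservation of order are all
  instances.\<close>

lemma
  fixes u :: "real \<Rightarrow> real"
  assumes u: "\<And>\<tau>. \<tau> \<in> {0..T} \<Longrightarrow> (u has_real_derivative u' \<tau>) (at \<tau> within {0..T})"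
    and le: "\<And>\<tau>. \<tau> \<in> {0..T} \<Longrightarrow> \<bar>u' \<tau>\<bar> \<le> K * \<bar>u \<tau>\<bar>" and t: "t \<in> {0..T}"
  shows linear_ode_growth: "\<bar>u t\<bar> \<le> \<bar>u 0\<bar> * exp (K * t)"
    and linear_ode_sgn: "sgn (u t) = sgn (u 0)"
proof -
  have deriv: "((\<lambda>\<tau>. (u \<tau>)\<^sup>2) has_real_derivative (2 * u \<tau> * u' \<tau>)) (at \<tau> within {0..T})" if "\<tau> \<in> {0..T}" for \<tau>
    using u[OF that] by (auto intro!: derivative_eq_intros)
  have prod: "\<bar>2 * u \<tau> * u' \<tau>\<bar> \<le> 2 * K * (u \<tau>)\<^sup>2" if "\<tau> \<in> {0..T}" for \<tau>
  proof -
    have "2 * \<bar>u \<tau>\<bar> * \<bar>u' \<tau>\<bar> \<le> 2 * \<bar>u \<tau>\<bar> * (K * \<bar>u \<tau>\<bar>)"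
      by (intro mult_left_mono le that) auto
    also have "\<dots> = 2 * K * \<bar>u \<tau>\<bar>\<^sup>2"
      by (simp add: power2_eq_square)
    finally show ?thesis by (simp add: abs_mult)
  qed
  have mono: "(u 0)\<^sup>2 \<le> (u s)\<^sup>2 * exp (2 * K * s)" if s: "s \<in> {0..T}" for s
  proof -
    let ?g = "\<lambda>\<tau>. (u \<tau>)\<^sup>2 * exp (2 * K * \<tau>)"
    have "?g 0 \<le> ?g s"
    proof (rule nonneg_deriv_within_imp_le[where T = T])
      fix \<tau> assume \<tau>: "\<tau> \<in> {0..T}"
      show "(?g has_real_derivative (2 * u \<tau> * u' \<tau> + 2 * K * (u \<tau>)\<^sup>2) * exp (2 * K * \<tau>)) (at \<tau> within {0..T})"
        by (rule derivative_eq_intros deriv[OF \<tau>] refl | simp add: algebra_simps)+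
      show "0 \<le> (2 * u \<tau> * u' \<tau> + 2 * K * (u \<tau>)\<^sup>2) * exp (2 * K * \<tau>)"
        using prod[OF \<tau>] by (auto intro!: mult_nonneg_nonneg)
    qed fact
    then show ?thesis by simp
  qed
  have "- ((u 0)\<^sup>2 * exp (- (2 * K * 0))) \<le> - ((u t)\<^sup>2 * exp (- (2 * K * t)))"
  proof (rule nonneg_deriv_within_imp_le[where T = T])
    fix \<tau> assume \<tau>: "\<tau> \<in> {0..T}"
    show "((\<lambda>\<tau>. - ((u \<tau>)\<^sup>2 * exp (- (2 * K * \<tau>)))) has_real_derivative
        (2 * K * (u \<tau>)\<^sup>2 - 2 * u \<tau> * u' \<tau>) * exp (- (2 * K * \<tau>))) (at \<tau> within {0..T})"
      by (rule derivative_eq_intros deriv[OF \<tau>] refl | simp add: algebra_simps)+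
    show "0 \<le> (2 * K * (u \<tau>)\<^sup>2 - 2 * u \<tau> * u' \<tau>) * exp (- (2 * K * \<tau>))"
      using prod[OF \<tau>] by (auto intro!: mult_nonneg_nonneg)
  qed fact
  then have "(u t)\<^sup>2 * exp (- (2 * K * t)) * exp (2 * K * t) \<le> (u 0)\<^sup>2 * exp (2 * K * t)"
    by (intro mult_right_mono) auto
  then have up: "(u t)\<^sup>2 \<le> (u 0)\<^sup>2 * exp (2 * K * t)"
    by (simp add: mult.assoc flip: exp_add)
  also have "\<dots> = (\<bar>u 0\<bar> * exp (K * t))\<^sup>2"
    by (simp add: power_mult_distrib flip: exp_double)
  finally show "\<bar>u t\<bar> \<le> \<bar>u 0\<bar> * exp (K * t)"
    by (metis abs_exp_cancel abs_le_square_iff abs_mult abs_abs)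
  show "sgn (u t) = sgn (u 0)"
  proof (cases "u 0 = 0")
    case True
    with up show ?thesis by simp
  next
    case False
    have nz: "u s \<noteq> 0" if "s \<in> {0..T}" for s
      using mono[OF that] False by auto
    have cont: "continuous_on {0..t} u"
      using t by (intro DERIV_continuous_on[OF DERIV_subset[OF u]]) auto
    have "0 < u 0 \<longleftrightarrow> 0 < u t"
      using IVT'[of u 0 0 t] IVT2'[of u t 0 0] cont nz t by (force simp: not_less less_le)
    with False nz[OF t] show ?thesis by (auto simp: sgn_if)
  qed
qed

section \<open>Cells of the uniform grid\<close>

interpretation unit_ivl: prob_space "\<lambda>\<^sub>I"
  by (rule prob_space_restrict_space) auto

text \<open>The maximum puts the end point 0 into the first cell.\<close>

definition idx :: "nat \<Rightarrow> real \<Rightarrow> nat"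
  where "idx N s = max 1 (nat \<lceil>real N * s\<rceil>)"

lemma idx_mono: "s \<le> s' \<Longrightarrow> idx N s \<le> idx N s'"
  unfolding idx_def by (intro max.mono nat_mono ceiling_mono mult_left_mono) auto

lemma idx_in_range: "1 \<le> N \<Longrightarrow> s \<in> \<I> \<Longrightarrow> idx N s \<in> {1..N}"
  unfolding idx_def by (auto simp: nat_le_iff ceiling_le_iff mult_left_le)

lemma idx_in_cell:
  assumes "1 \<le> N" "s \<in> \<I>"
  shows "s \<in> cell N (idx N s)"
proof (cases "s = 0")
  case False
  with assms have "0 < real N * s" by auto
  then have "1 \<le> \<lceil>real N * s\<rceil>" by linarith
  then have "real (idx N s) = of_int \<lceil>real N * s\<rceil>"
    unfolding idx_def by linarith
  with assms show ?thesis
    by (auto simp: cell_def field_simps) linarith+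
qed (use assms in \<open>auto simp: idx_def cell_def\<close>)

lemma idx_measurable [measurable]: "idx N \<in> measurable \<lambda>\<^sub>I (count_space UNIV)"
proof -
  have "(\<lambda>s. real N * s) \<in> borel_measurable \<lambda>\<^sub>I"
    by (intro borel_measurable_times borel_measurable_const measurable_restrict_space1)
       (simp add: measurable_completion)
  then have "(\<lambda>s. \<lceil>real N * s\<rceil>) \<in> measurable \<lambda>\<^sub>I (count_space UNIV)"
    by measurable
  then show ?thesis
    unfolding idx_def by (rule measurable_compose) simp
qed

text \<open>The closed cells overlap at the interior grid points, where \<open>step_fun\<close> adds
  two values; the finitely many grid points are removed. The quantifier over \<open>v\<close> stands
  inside, so one null set serves all vectors.\<close>

lemma AE_step_fun_eq:
  assumes N: "1 \<le> N"
  shows "AE s in \<lambda>\<^sub>I. \<forall>v. step_fun N v s = v (idx N s)"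
proof -
  have "negligible ((\<lambda>k. real k / real N) ` {0..N})"
    by (intro negligible_finite finite_imageI) auto
  then have "AE s in lebesgue. s \<notin> (\<lambda>k. real k / real N) ` {0..N}"
    by (auto simp: negligible_iff_null_sets intro: AE_not_in)
  then have "AE s in lebesgue. s \<in> \<I> \<longrightarrow> (\<forall>v. step_fun N v s = v (idx N s))"
  proof eventually_elim
    case (elim s)
    show ?case
    proof (intro impI allI)
      fix v assume s: "s \<in> \<I>"
      have "indicator (cell N i) s = (if i = idx N s then 1 else 0 :: real)" if i: "i \<in> {1..N}" for i
      proof (cases "s \<in> cell N i")
        case True
        have "s \<noteq> real (i - 1) / real N" "s \<noteq> real i / real N"
          using elim i by (auto simp del: of_nat_diff of_nat_diff_if)
        with True N have "real i - 1 < real N * s" "real N * s < real i"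
          using i by (auto simp: cell_def field_simps less_le of_nat_diff)
        then have "\<lceil>real N * s\<rceil> = int i" by linarith
        with i True show ?thesis by (simp add: idx_def)
      next
        case False
        with idx_in_cell[OF N s] show ?thesis by auto
      qed
      then have "step_fun N v s = (\<Sum>i=1..N. if i = idx N s then v i else 0)"
        unfolding step_fun_def by (intro sum.cong) auto
      then show "step_fun N v s = v (idx N s)"
        using idx_in_range[OF N s] by simp
    qed
  qed
  then show ?thesis by (subst AE_restrict_space_iff) auto
qed

lemma cell_subset: "i \<in> {1..N} \<Longrightarrow> cell N i \<subseteq> \<I>"
  by (auto simp: cell_def field_simps intro: order_trans)

lemma cell_sets [measurable]: "cell N i \<in> sets lebesgue"
  by (simp add: cell_def)

lemma measure_cell: "i \<in> {1..N} \<Longrightarrow> measure \<lambda>\<^sub>I (cell N i) = 1 / real N"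
  using cell_subset[of i N]
  by (subst measure_restrict_space) (auto simp: cell_def field_simps)

lemma cell_sets_unit: "i \<in> {1..N} \<Longrightarrow> cell N i \<in> sets \<lambda>\<^sub>I"
  using cell_subset[of i N] by (simp add: sets_restrict_space_iff)

lemma step_fun_measurable [measurable]: "step_fun N v \<in> borel_measurable \<lambda>\<^sub>I"
  unfolding step_fun_def[abs_def] using cell_sets_unit
  by (intro borel_measurable_sum borel_measurable_times borel_measurable_const borel_measurable_indicator)

lemma integral_step_fun: "(LINT s|\<lambda>\<^sub>I. step_fun N v s) = (\<Sum>i=1..N. v i) / real N"
proof -
  have "integrable \<lambda>\<^sub>I (\<lambda>s. v i * indicator (cell N i) s)" if "i \<in> {1..N}" for i
    using cell_sets_unit[OF that]
    by (intro integrable_mult_right integrable_real_indicator) (auto simp: unit_ivl.emeasure_eq_measure)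
  then have "(LINT s|\<lambda>\<^sub>I. step_fun N v s) = (\<Sum>i=1..N. LINT s|\<lambda>\<^sub>I. v i * indicator (cell N i) s)"
    unfolding step_fun_def by (intro Bochner_Integration.integral_sum) auto
  also have "\<dots> = (\<Sum>i=1..N. v i * (1 / real N))"
    using measure_cell cell_subset by (intro sum.cong) (auto simp: Int_absorb1 Int_absorb2)
  finally show ?thesis by (simp add: sum_divide_distrib)
qed

lemma idx_comp_measurable [measurable]: "(\<lambda>s. f (idx N s)) \<in> borel_measurable \<lambda>\<^sub>I"
  by (rule measurable_compose[OF idx_measurable]) simp

lemma integral_idx:
  assumes N: "1 \<le> N"
  shows "(LINT s|\<lambda>\<^sub>I. v (idx N s)) = (\<Sum>i=1..N. v i) / real N"
proof -
  have "(LINT s|\<lambda>\<^sub>I. v (idx N s)) = (LINT s|\<lambda>\<^sub>I. step_fun N v s)"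
    using AE_step_fun_eq[OF N] by (intro integral_cong_AE) auto
  then show ?thesis by (simp add: integral_step_fun)
qed

lemma cell_avg_eq:
  assumes "i \<in> {1..N}"
  shows "cell_avg N i f = real N * (LINT s|\<lambda>\<^sub>I. indicator (cell N i) s * f s)"
proof -
  have "(LINT s|lebesgue_on (cell N i). f s) = (LINT s|lebesgue. indicator (cell N i) s * f s)"
    by (subst integral_restrict_space) auto
  also have "\<dots> = (LINT s|lebesgue. indicator \<I> s * (indicator (cell N i) s * f s))"
    using cell_subset[OF assms] by (intro Bochner_Integration.integral_cong) (auto split: split_indicator)
  also have "\<dots> = (LINT s|\<lambda>\<^sub>I. indicator (cell N i) s * f s)"
    by (subst integral_restrict_space) auto
  finally show ?thesis by (simp add: cell_avg_def)
qed

text \<open>Converse of \<open>idx_in_cell\<close>; it fails at interior grid points, which lie in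
  two cells. Off the null set of \<open>AE_step_fun_eq\<close>, the step function of the unit vector
  for \<open>i\<close> detects whether the index is \<open>i\<close>.\<close>

lemma AE_idx_eq_if_in_cell:
  assumes N: "1 \<le> N"
  shows "AE s in \<lambda>\<^sub>I. \<forall>i\<in>{1..N}. s \<in> cell N i \<longrightarrow> idx N s = i"
  using AE_step_fun_eq[OF N] AE_space
proof eventually_elim
  case (elim s)
  show ?case
  proof (intro ballI impI)
    fix i assume i: "i \<in> {1..N}" "s \<in> cell N i"
    have "step_fun N (\<lambda>j. if j = i then 1 else 0) s = (\<Sum>j=1..N. if j = i then 1 else 0)"
      unfolding step_fun_def using i by (intro sum.cong) auto
    also have "\<dots> = 1" using i by simp
    finally show "idx N s = i"
      using elim by (simp split: if_splits)
  qed
qed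

section \<open>Cell averages\<close>

lemma continuous_on_unit_measurable:
  fixes f :: "real \<Rightarrow> real"
  assumes "continuous_on \<I> f"
  shows "f \<in> borel_measurable \<lambda>\<^sub>I"
  using assms by (intro continuous_imp_measurable_on_sets_lebesgue) auto

lemma integrable_bounded_unit:
  fixes f :: "real \<Rightarrow> real"
  assumes "f \<in> borel_measurable \<lambda>\<^sub>I" "AE s in \<lambda>\<^sub>I. \<bar>f s\<bar> \<le> B"
  shows "integrable \<lambda>\<^sub>I f"
  using assms by (intro unit_ivl.integrable_const_bound[where B = B]) auto

text \<open>Serves two purposes: orthogonality of the projection onto step functions and, with
  \<open>W\<close> constant 1, the total initial mass of the finite system.\<close>

lemma integral_mult_idx:
  assumes N: "1 \<le> N" and f: "integrable \<lambda>\<^sub>I f"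
  shows "(LINT s|\<lambda>\<^sub>I. f s * W (idx N s)) = (\<Sum>i=1..N. cell_avg N i f * W i) / real N"
proof -
  have [measurable]: "f \<in> borel_measurable \<lambda>\<^sub>I" using f by auto
  have int: "integrable \<lambda>\<^sub>I (\<lambda>s. indicator (cell N i) s * f s)" if "i \<in> {1..N}" for i
    using integrable_mult_indicator[OF cell_sets_unit[OF that] f] by simp
  have "(LINT s|\<lambda>\<^sub>I. f s * W (idx N s)) = (LINT s|\<lambda>\<^sub>I. f s * step_fun N W s)"
    using AE_step_fun_eq[OF N] by (intro Bochner_Integration.integral_cong_AE) auto
  also have "\<dots> = (LINT s|\<lambda>\<^sub>I. (\<Sum>i=1..N. W i * (indicator (cell N i) s * f s)))"
    by (simp only: step_fun_def sum_distrib_left mult_ac)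
  also have "\<dots> = (\<Sum>i=1..N. W i * (LINT s|\<lambda>\<^sub>I. indicator (cell N i) s * f s))"
    using int by (subst Bochner_Integration.integral_sum) auto
  also have "\<dots> = (\<Sum>i=1..N. cell_avg N i f * W i / real N)"
    using N by (intro sum.cong) (auto simp: cell_avg_eq)
  finally show ?thesis by (simp add: sum_divide_distrib)
qed

lemma idx_comp_bounded: "\<exists>B. \<forall>s\<in>\<I>. \<bar>c (idx N s)\<bar> \<le> (B::real)"
proof -
  \<comment> \<open>For \<open>N = 0\<close> the range \<open>{1..N}\<close> is empty, but
    \<open>idx\<close> still returns 1.\<close>
  have "\<bar>c (idx N s)\<bar> \<le> (\<Sum>i\<in>insert 1 {1..N}. \<bar>c i\<bar>)" if "s \<in> \<I>" for s
  proof (rule member_le_sum)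
    show "idx N s \<in> insert 1 {1..N}"
      using idx_in_range[of N s] that by (cases N) (auto simp: idx_def)
  qed auto
  then show ?thesis by blast
qed

text \<open>The averages of \<open>f\<close> over the cells are its orthogonal projection onto the step functions.\<close>

lemma cell_avg_best_approximation:
  assumes N: "1 \<le> N" and f [measurable]: "f \<in> borel_measurable \<lambda>\<^sub>I" and B: "AE s in \<lambda>\<^sub>I. \<bar>f s\<bar> \<le> B"
  shows "(LINT s|\<lambda>\<^sub>I. (cell_avg N (idx N s) f - f s)\<^sup>2) \<le> (LINT s|\<lambda>\<^sub>I. (c (idx N s) - f s)\<^sup>2)"
proof -
  define W where "W i = cell_avg N i f - c i" for i
  let ?p = "\<lambda>s. cell_avg N (idx N s) f"
  obtain P where P: "\<forall>s\<in>\<I>. \<bar>?p s\<bar> \<le> P"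
    using idx_comp_bounded[of "\<lambda>i. cell_avg N i f" N] by auto
  obtain Q where Q: "\<forall>s\<in>\<I>. \<bar>W (idx N s)\<bar> \<le> Q" using idx_comp_bounded by blast
  have "0 \<le> Q" using Q by force
  have p: "AE s in \<lambda>\<^sub>I. \<bar>?p s - f s\<bar> \<le> P + B"
    using B AE_space by eventually_elim (use P in force)
  have pW: "integrable \<lambda>\<^sub>I (\<lambda>s. ?p s * W (idx N s))"
    using P Q \<open>0 \<le> Q\<close> by (intro integrable_bounded_unit[where B = "P * Q"] AE_I2) (auto simp: abs_mult intro!: mult_mono)
  have sq: "integrable \<lambda>\<^sub>I (\<lambda>s. (?p s - f s)\<^sup>2)"
  proof (rule integrable_bounded_unit)
    show "AE s in \<lambda>\<^sub>I. \<bar>(?p s - f s)\<^sup>2\<bar> \<le> (P + B)\<^sup>2"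
      using p by eventually_elim (simp add: abs_le_square_iff[symmetric])
  qed measurable
  have W: "integrable \<lambda>\<^sub>I (\<lambda>s. (W (idx N s))\<^sup>2)"
    using Q \<open>0 \<le> Q\<close> by (intro integrable_bounded_unit[where B = "Q\<^sup>2"] AE_I2) (auto simp: abs_le_square_iff[symmetric])
  have fi: "integrable \<lambda>\<^sub>I f" using B by (intro integrable_bounded_unit) auto
  have fW: "integrable \<lambda>\<^sub>I (\<lambda>s. f s * W (idx N s))"
  proof (rule integrable_bounded_unit)
    show "AE s in \<lambda>\<^sub>I. \<bar>f s * W (idx N s)\<bar> \<le> B * Q"
      using B AE_space by eventually_elim (use Q in \<open>auto simp: abs_mult intro!: mult_mono\<close>)
  qed measurable
  have "(LINT s|\<lambda>\<^sub>I. (c (idx N s) - f s)\<^sup>2)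
    = (LINT s|\<lambda>\<^sub>I. (?p s - f s)\<^sup>2 + (W (idx N s))\<^sup>2 - 2 * (?p s * W (idx N s)) + 2 * (f s * W (idx N s)))"
    by (intro Bochner_Integration.integral_cong) (auto simp: W_def power2_eq_square algebra_simps)
  also have "\<dots> = (LINT s|\<lambda>\<^sub>I. (?p s - f s)\<^sup>2) + (LINT s|\<lambda>\<^sub>I. (W (idx N s))\<^sup>2)
      - 2 * (LINT s|\<lambda>\<^sub>I. ?p s * W (idx N s)) + 2 * (LINT s|\<lambda>\<^sub>I. f s * W (idx N s))"
    using sq W pW fW by simp
  \<comment> \<open>Orthogonality: \<open>?p\<close> and \<open>f\<close> have the same integral
    against the step function of \<open>W\<close>, so the cross terms cancel.\<close>
  also have "(LINT s|\<lambda>\<^sub>I. ?p s * W (idx N s)) = (LINT s|\<lambda>\<^sub>I. f s * W (idx N s))"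
    using integral_idx[OF N, of "\<lambda>i. cell_avg N i f * W i"] by (simp add: integral_mult_idx[OF N fi])
  finally have "(LINT s|\<lambda>\<^sub>I. (c (idx N s) - f s)\<^sup>2) = (LINT s|\<lambda>\<^sub>I. (?p s - f s)\<^sup>2) + (LINT s|\<lambda>\<^sub>I. (W (idx N s))\<^sup>2)"
    by simp
  moreover have "0 \<le> (LINT s|\<lambda>\<^sub>I. (W (idx N s))\<^sup>2)"
    by (intro Bochner_Integration.integral_nonneg) simp
  ultimately show ?thesis by linarith
qed

text \<open>Measurability supplies continuous functions that converge almost everywhere. Clamping
  them to \<open>[-B, B]\<close> leaves the limit unchanged, because \<open>f\<close> obeys the same
  bound, and yields a dominating constant.\<close>

lemma L2_continuous_approximation:
  fixes f :: "real \<Rightarrow> real"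
  assumes f [measurable]: "f \<in> borel_measurable \<lambda>\<^sub>I" and B: "AE s in \<lambda>\<^sub>I. \<bar>f s\<bar> \<le> B" and "0 < \<epsilon>"
  obtains g where "continuous_on UNIV g" "\<And>s. \<bar>g s\<bar> \<le> B" "(LINT s|\<lambda>\<^sub>I. (g s - f s)\<^sup>2) < \<epsilon>"
proof -
  have "AE s in \<lambda>\<^sub>I. 0 \<le> B"
    using B by eventually_elim linarith
  then have "0 \<le> B" by simp
  from f have "f measurable_on \<I>"
    by (simp add: measurable_on_iff_borel_measurable)
  then obtain Z g where Z: "negligible Z" and g: "\<And>k. continuous_on UNIV (g k)"
    and lim: "\<And>s. s \<notin> Z \<Longrightarrow> (\<lambda>k. g k s) \<longlonglongrightarrow> (if s \<in> \<I> then f s else 0)"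
    unfolding measurable_on_def by blast
  define h where "h k s = max (- B) (min B (g k s))" for k s
  have h: "continuous_on UNIV (h k)" "\<bar>h k s\<bar> \<le> B" for k s
    unfolding h_def using g[of k] \<open>0 \<le> B\<close> by (auto intro!: continuous_intros simp: abs_le_iff)
  have [measurable]: "h k \<in> borel_measurable \<lambda>\<^sub>I" for k
    using continuous_on_subset[OF h(1)] by (intro continuous_on_unit_measurable) auto
  have "AE s in lebesgue. s \<notin> Z"
    using Z by (auto simp: negligible_iff_null_sets intro: AE_not_in)
  then have notZ: "AE s in \<lambda>\<^sub>I. s \<notin> Z"
    by (subst AE_restrict_space_iff) (auto elim: eventually_mono)
  have "(\<lambda>k. LINT s|\<lambda>\<^sub>I. (h k s - f s)\<^sup>2) \<longlonglongrightarrow> (LINT s|\<lambda>\<^sub>I. 0)"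
  proof (rule integral_dominated_convergence[where w = "\<lambda>_. (2 * B)\<^sup>2"])
    show "AE s in \<lambda>\<^sub>I. (\<lambda>k. (h k s - f s)\<^sup>2) \<longlonglongrightarrow> 0"
      using notZ B AE_space
    proof eventually_elim
      case (elim s)
      then have "(\<lambda>k. g k s) \<longlonglongrightarrow> f s" using lim[of s] by auto
      then have "(\<lambda>k. (h k s - f s)\<^sup>2) \<longlonglongrightarrow> (max (- B) (min B (f s)) - f s)\<^sup>2"
        unfolding h_def by (intro tendsto_intros)
      moreover have "max (- B) (min B (f s)) = f s" using elim(2) by auto
      ultimately show ?case by simp
    qed
    show "AE s in \<lambda>\<^sub>I. norm ((h k s - f s)\<^sup>2) \<le> (2 * B)\<^sup>2" for k
      using B
    proof eventually_elim
      case (elim s)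
      then have "\<bar>h k s - f s\<bar> \<le> 2 * B" using h(2)[of k s] by linarith
      then have "\<bar>h k s - f s\<bar>\<^sup>2 \<le> (2 * B)\<^sup>2" by (intro power_mono) auto
      then show ?case by simp
    qed
  qed auto
  then have "\<forall>\<^sub>F k in sequentially. (LINT s|\<lambda>\<^sub>I. (h k s - f s)\<^sup>2) < \<epsilon>"
    using \<open>0 < \<epsilon>\<close> by (intro order_tendstoD) auto
  then obtain k where "(LINT s|\<lambda>\<^sub>I. (h k s - f s)\<^sup>2) < \<epsilon>"
    by (auto simp: eventually_sequentially)
  with h show thesis by (intro that)
qed

text \<open>By best approximation it suffices to exhibit some step functions close to
  \<open>f\<close>. Samples of a continuous approximant \<open>g\<close> serve, since
  \<open>g\<close> is uniformly continuous on \<open>\<I>\<close>. With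
  \<open>(p + q)\<^sup>2 \<le> 2 * p\<^sup>2 + 2 * q\<^sup>2\<close> the thresholds
  \<open>\<epsilon> / 8\<close> and \<open>\<epsilon> / 4\<close> add up to three quarters of
  \<open>\<epsilon>\<close>.\<close>

lemma cell_avg_tendsto_L2:
  assumes f [measurable]: "f \<in> borel_measurable \<lambda>\<^sub>I" and B: "AE s in \<lambda>\<^sub>I. \<bar>f s\<bar> \<le> B"
  shows "(\<lambda>N. LINT s|\<lambda>\<^sub>I. (cell_avg N (idx N s) f - f s)\<^sup>2) \<longlonglongrightarrow> 0"
proof (rule tendstoI)
  fix \<epsilon> :: real assume "0 < \<epsilon>"
  then have "0 < \<epsilon> / 4" by simp
  obtain g where g: "continuous_on UNIV g" "\<And>s. \<bar>g s\<bar> \<le> B" "(LINT s|\<lambda>\<^sub>I. (g s - f s)\<^sup>2) < \<epsilon> / 4"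
    using L2_continuous_approximation[OF f B \<open>0 < \<epsilon> / 4\<close>] by blast
  have gI: "continuous_on \<I> g" using g(1) by (rule continuous_on_subset) simp
  then have [measurable]: "g \<in> borel_measurable \<lambda>\<^sub>I" by (rule continuous_on_unit_measurable)
  have "uniformly_continuous_on \<I> g"
    using gI by (intro compact_uniformly_continuous) auto
  then obtain \<delta> where \<delta>: "0 < \<delta>" "\<And>s s'. s \<in> \<I> \<Longrightarrow> s' \<in> \<I> \<Longrightarrow> dist s' s < \<delta> \<Longrightarrow> dist (g s') (g s) < sqrt (\<epsilon> / 8)"
    unfolding uniformly_continuous_on_def using \<open>0 < \<epsilon>\<close> by (metis real_sqrt_gt_zero zero_less_divide_iff zero_less_numeral)
  have "\<forall>\<^sub>F N in sequentially. 1 / real N < \<delta>"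
    using \<delta>(1) by (intro order_tendstoD(2)[OF lim_1_over_n]) auto
  then show "\<forall>\<^sub>F N in sequentially. dist (LINT s|\<lambda>\<^sub>I. (cell_avg N (idx N s) f - f s)\<^sup>2) 0 < \<epsilon>"
    using eventually_ge_at_top[of 1]
  proof eventually_elim
    case (elim N)
    \<comment> \<open>The right end point of a cell is within \<open>1 / N\<close> of all its
      points.\<close>
    let ?c = "\<lambda>i. g (real i / real N)"
    have near: "(?c (idx N s) - g s)\<^sup>2 \<le> \<epsilon> / 8" if s: "s \<in> \<I>" for s
    proof -
      have i: "idx N s \<in> {1..N}" by (rule idx_in_range[OF elim(2) s])
      then have "real (idx N s) / real N \<in> \<I>" by auto
      moreover have "dist (real (idx N s) / real N) s < \<delta>"
        using idx_in_cell[OF elim(2) s] elim(1) by (auto simp: cell_def dist_real_def diff_divide_distrib)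
      ultimately have "\<bar>?c (idx N s) - g s\<bar> \<le> sqrt (\<epsilon> / 8)"
        using \<delta>(2)[OF s, of "real (idx N s) / real N"] by (simp add: dist_real_def)
      then have "\<bar>?c (idx N s) - g s\<bar>\<^sup>2 \<le> (sqrt (\<epsilon> / 8))\<^sup>2"
        by (intro power_mono) auto
      with \<open>0 < \<epsilon>\<close> show ?thesis by simp
    qed
    have int: "integrable \<lambda>\<^sub>I (\<lambda>s. (g s - f s)\<^sup>2)"
    proof (rule integrable_bounded_unit)
      show "AE s in \<lambda>\<^sub>I. \<bar>(g s - f s)\<^sup>2\<bar> \<le> (2 * B)\<^sup>2"
        using B
      proof eventually_elim
        case (elim s)
        then have "\<bar>g s - f s\<bar> \<le> 2 * B" using g(2)[of s] by linarith
        then have "\<bar>g s - f s\<bar>\<^sup>2 \<le> (2 * B)\<^sup>2" by (intro power_mono) auto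
        then show ?case by simp
      qed
    qed measurable
    have "(LINT s|\<lambda>\<^sub>I. (cell_avg N (idx N s) f - f s)\<^sup>2) \<le> (LINT s|\<lambda>\<^sub>I. (?c (idx N s) - f s)\<^sup>2)"
      by (rule cell_avg_best_approximation[OF elim(2) f B])
    also have "\<dots> \<le> (LINT s|\<lambda>\<^sub>I. \<epsilon> / 4 + 2 * (g s - f s)\<^sup>2)"
    proof (rule integral_mono_AE')
      show "AE s in \<lambda>\<^sub>I. (?c (idx N s) - f s)\<^sup>2 \<le> \<epsilon> / 4 + 2 * (g s - f s)\<^sup>2"
      proof (rule AE_I2)
        fix s assume "s \<in> space \<lambda>\<^sub>I"
        then have "(?c (idx N s) - g s)\<^sup>2 \<le> \<epsilon> / 8" by (intro near) simp
        moreover have "(p + q)\<^sup>2 \<le> 2 * p\<^sup>2 + 2 * q\<^sup>2" for p q :: real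
          using sum_squares_bound[of p q] by (simp add: power2_sum)
        from this[of "?c (idx N s) - g s" "g s - f s"]
        have "(?c (idx N s) - f s)\<^sup>2 \<le> 2 * (?c (idx N s) - g s)\<^sup>2 + 2 * (g s - f s)\<^sup>2" by simp
        ultimately show "(?c (idx N s) - f s)\<^sup>2 \<le> \<epsilon> / 4 + 2 * (g s - f s)\<^sup>2" by linarith
      qed
    qed (use int \<open>0 < \<epsilon>\<close> in auto)
    also have "\<dots> = \<epsilon> / 4 + 2 * (LINT s|\<lambda>\<^sub>I. (g s - f s)\<^sup>2)"
      using int unit_ivl.prob_space by simp
    also have "\<dots> < \<epsilon>" using g(3) \<open>0 < \<epsilon>\<close> by linarith
    finally have "(LINT s|\<lambda>\<^sub>I. (cell_avg N (idx N s) f - f s)\<^sup>2) < \<epsilon>" .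
    moreover have "0 \<le> (LINT s|\<lambda>\<^sub>I. (cell_avg N (idx N s) f - f s)\<^sup>2)"
      by (intro Bochner_Integration.integral_nonneg) simp
    ultimately show ?case by simp
  qed
qed

lemma cell_avg_between:
  assumes i: "i \<in> {1..N}" and f: "f \<in> borel_measurable \<lambda>\<^sub>I" and b: "AE s in \<lambda>\<^sub>I. b \<le> f s \<and> f s \<le> B"
  shows "b \<le> cell_avg N i f" "cell_avg N i f \<le> B"
proof -
  have N: "0 < real N" using i by auto
  have ind: "integrable \<lambda>\<^sub>I (indicator (cell N i) :: real \<Rightarrow> real)"
    using cell_sets_unit[OF i] by (auto intro!: integrable_real_indicator simp: unit_ivl.emeasure_eq_measure)
  have m: "(LINT s|\<lambda>\<^sub>I. indicator (cell N i) s * k) = k / real N" for k :: real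
    using cell_subset[OF i] measure_cell[OF i] by (simp add: Int_absorb1 Int_absorb2)
  have "integrable \<lambda>\<^sub>I f"
  proof (rule integrable_bounded_unit[OF f])
    show "AE s in \<lambda>\<^sub>I. \<bar>f s\<bar> \<le> max \<bar>b\<bar> \<bar>B\<bar>"
      using b by eventually_elim auto
  qed
  from integrable_mult_indicator[OF cell_sets_unit[OF i] this]
  have fi: "integrable \<lambda>\<^sub>I (\<lambda>s. indicator (cell N i) s * f s)" by simp
  have "(LINT s|\<lambda>\<^sub>I. indicator (cell N i) s * b) \<le> (LINT s|\<lambda>\<^sub>I. indicator (cell N i) s * f s)"
  proof (rule integral_mono_AE)
    show "AE s in \<lambda>\<^sub>I. indicator (cell N i) s * b \<le> indicator (cell N i) s * f s"
      using b by eventually_elim (auto split: split_indicator)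
  qed (use ind fi in auto)
  then have "b / real N \<le> (LINT s|\<lambda>\<^sub>I. indicator (cell N i) s * f s)" by (simp only: m)
  with N show "b \<le> cell_avg N i f" by (simp add: cell_avg_eq[OF i] field_simps)
  have "(LINT s|\<lambda>\<^sub>I. indicator (cell N i) s * f s) \<le> (LINT s|\<lambda>\<^sub>I. indicator (cell N i) s * B)"
  proof (rule integral_mono_AE)
    show "AE s in \<lambda>\<^sub>I. indicator (cell N i) s * f s \<le> indicator (cell N i) s * B"
      using b by eventually_elim (auto split: split_indicator)
  qed (use ind fi in auto)
  then have "(LINT s|\<lambda>\<^sub>I. indicator (cell N i) s * f s) \<le> B / real N" by (simp only: m)
  with N show "cell_avg N i f \<le> B" by (simp add: cell_avg_eq[OF i] field_simps)
qed

text \<open>The mean value theorem is applied to the primitive of \<open>f\<close> because it gives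
  a point of the open cell. Points taken from different cells are then strictly ordered, as
  \<open>initial_order\<close> requires.\<close>

lemma cell_avg_mean_value:
  assumes i: "i \<in> {1..N}" and f: "continuous_on \<I> f"
  obtains \<xi> where "(real i - 1) / real N < \<xi>" "\<xi> < real i / real N" "cell_avg N i f = f \<xi>"
proof -
  let ?l = "(real i - 1) / real N" and ?r = "real i / real N"
  have lr: "?l < ?r" using i by (auto simp: divide_strict_right_mono)
  have cell: "cell N i = {?l..?r}" by (simp add: cell_def)
  have fc: "continuous_on {?l..?r} f"
    using f cell_subset[OF i] unfolding cell by (rule continuous_on_subset)
  have "((\<lambda>u. integral {?l..u} f) has_derivative (\<lambda>h. f u * h)) (at u within {?l..?r})" if "?l \<le> u" "u \<le> ?r" for u
    using integral_has_real_derivative[OF fc, of u] that by (auto simp: has_field_derivative_def)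
  from mvt_simple[OF lr this] obtain \<xi> where \<xi>: "\<xi> \<in> {?l<..<?r}" "integral {?l..?r} f - integral {?l..?l} f = f \<xi> * (?r - ?l)"
    by auto
  have "integrable (lebesgue_on {?l..?r}) f"
    using fc by (rule continuous_imp_integrable_real)
  then have "cell_avg N i f = real N * integral {?l..?r} f"
    by (simp add: cell_avg_def cell lebesgue_integral_eq_integral)
  also have "\<dots> = f \<xi>"
    using \<xi>(2) i by (simp add: field_simps)
  finally show thesis using \<xi>(1) by (intro that) auto
qed

section \<open>Differentiation in the essential supremum norm\<close>

text \<open>
  The derivative of a curve with respect to the essential supremum norm, multiplied out so that no
  division by \<open>\<tau> - t\<close> occurs.
\<close>

definition Linf_deriv :: "real \<Rightarrow> (real \<Rightarrow> real \<Rightarrow> real) \<Rightarrow> (real \<Rightarrow> real) \<Rightarrow> real \<Rightarrow> bool"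
  where "Linf_deriv T u v t \<longleftrightarrow> (\<forall>\<epsilon>>0. \<forall>\<^sub>F \<tau> in at t within {0..T}.
    AE s in \<lambda>\<^sub>I. \<bar>u \<tau> s - u t s - (\<tau> - t) * v s\<bar> \<le> \<epsilon> * \<bar>\<tau> - t\<bar>)"

lemma Linf_deriv_diff:
  assumes "Linf_deriv T u u' t" "Linf_deriv T v v' t"
  shows "Linf_deriv T (\<lambda>\<tau> s. u \<tau> s - v \<tau> s) (\<lambda>s. u' s - v' s) t"
  unfolding Linf_deriv_def
proof (intro allI impI)
  fix \<epsilon> :: real assume "0 < \<epsilon>"
  then have "0 < \<epsilon> / 2" by simp
  with assms have
    "\<forall>\<^sub>F \<tau> in at t within {0..T}. AE s in \<lambda>\<^sub>I. \<bar>u \<tau> s - u t s - (\<tau> - t) * u' s\<bar> \<le> \<epsilon> / 2 * \<bar>\<tau> - t\<bar>"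
    "\<forall>\<^sub>F \<tau> in at t within {0..T}. AE s in \<lambda>\<^sub>I. \<bar>v \<tau> s - v t s - (\<tau> - t) * v' s\<bar> \<le> \<epsilon> / 2 * \<bar>\<tau> - t\<bar>"
    unfolding Linf_deriv_def by blast+
  then show "\<forall>\<^sub>F \<tau> in at t within {0..T}. AE s in \<lambda>\<^sub>I.
      \<bar>u \<tau> s - v \<tau> s - (u t s - v t s) - (\<tau> - t) * (u' s - v' s)\<bar> \<le> \<epsilon> * \<bar>\<tau> - t\<bar>"
  proof eventually_elim
    case (elim \<tau>)
    then show ?case
    proof eventually_elim
      case (elim s)
      have "\<bar>u \<tau> s - v \<tau> s - (u t s - v t s) - (\<tau> - t) * (u' s - v' s)\<bar>
        = \<bar>(u \<tau> s - u t s - (\<tau> - t) * u' s) - (v \<tau> s - v t s - (\<tau> - t) * v' s)\<bar>"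
        by (simp add: algebra_simps)
      also have "\<dots> \<le> \<epsilon> / 2 * \<bar>\<tau> - t\<bar> + \<epsilon> / 2 * \<bar>\<tau> - t\<bar>"
        using elim by linarith
      finally show ?case by simp
    qed
  qed
qed

lemma Linf_norm_less_imp_AE:
  assumes "Linf_norm f < ereal c"
  shows "AE s in \<lambda>\<^sub>I. \<bar>f s\<bar> \<le> c"
  using esssup_AE[of "\<lambda>s. ereal \<bar>f s\<bar>" "\<lambda>\<^sub>I"]
proof eventually_elim
  case (elim s)
  then have "ereal \<bar>f s\<bar> < ereal c"
    using assms unfolding Linf_norm_def by (rule order.strict_trans1)
  then show ?case by simp
qed

lemma C_norm_less_imp:
  assumes "C_norm f < ereal c" "s \<in> \<I>"
  shows "\<bar>f s\<bar> \<le> c"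
proof -
  have "ereal \<bar>f s\<bar> \<le> C_norm f"
    unfolding C_norm_def by (intro SUP_upper assms)
  also note assms(1)
  finally show ?thesis by simp
qed

lemma abs_diff_quotient_le_imp:
  fixes u u' v :: real
  assumes "\<bar>(u' - u) / h - v\<bar> \<le> c" "h \<noteq> 0"
  shows "\<bar>u' - u - h * v\<bar> \<le> c * \<bar>h\<bar>"
proof -
  have "\<bar>u' - u - h * v\<bar> = \<bar>(u' - u) / h - v\<bar> * \<bar>h\<bar>"
    using assms(2) by (simp add: field_simps flip: abs_mult)
  then show ?thesis
    using assms(1) by (simp add: mult_right_mono)
qed

lemma has_C1_derivative_Linf_imp_Linf_deriv:
  assumes "has_C1_derivative V Linf_norm T u u'" "t \<in> {0..T}"
  shows "Linf_deriv T u (u' t) t"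
  unfolding Linf_deriv_def
proof (intro allI impI)
  fix \<epsilon> :: real assume "0 < \<epsilon>"
  have "((\<lambda>\<tau>. Linf_norm (\<lambda>s. (u \<tau> s - u t s) / (\<tau> - t) - u' t s)) \<longlongrightarrow> 0) (at t within {0..T})"
    using assms by (auto simp: has_C1_derivative_def)
  then have "\<forall>\<^sub>F \<tau> in at t within {0..T}. Linf_norm (\<lambda>s. (u \<tau> s - u t s) / (\<tau> - t) - u' t s) < ereal \<epsilon>"
    using \<open>0 < \<epsilon>\<close> by (intro order_tendstoD) auto
  moreover have "\<forall>\<^sub>F \<tau> in at t within {0..T}. \<tau> \<noteq> t"
    by (simp add: eventually_at_filter)
  ultimately show "\<forall>\<^sub>F \<tau> in at t within {0..T}. AE s in \<lambda>\<^sub>I. \<bar>u \<tau> s - u t s - (\<tau> - t) * u' t s\<bar> \<le> \<epsilon> * \<bar>\<tau> - t\<bar>"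
  proof eventually_elim
    case (elim \<tau>)
    from Linf_norm_less_imp_AE[OF elim(1)] show ?case
      by eventually_elim (use elim(2) in \<open>auto intro: abs_diff_quotient_le_imp\<close>)
  qed
qed

lemma has_C1_derivative_C_eventually:
  assumes "has_C1_derivative V C_norm T u u'" "t \<in> {0..T}" "0 < \<epsilon>"
  shows "\<forall>\<^sub>F \<tau> in at t within {0..T}. \<forall>s\<in>\<I>. \<bar>u \<tau> s - u t s - (\<tau> - t) * u' t s\<bar> \<le> \<epsilon> * \<bar>\<tau> - t\<bar>"
proof -
  have "((\<lambda>\<tau>. C_norm (\<lambda>s. (u \<tau> s - u t s) / (\<tau> - t) - u' t s)) \<longlongrightarrow> 0) (at t within {0..T})"
    using assms by (auto simp: has_C1_derivative_def)
  then have "\<forall>\<^sub>F \<tau> in at t within {0..T}. C_norm (\<lambda>s. (u \<tau> s - u t s) / (\<tau> - t) - u' t s) < ereal \<epsilon>"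
    using \<open>0 < \<epsilon>\<close> by (intro order_tendstoD) auto
  moreover have "\<forall>\<^sub>F \<tau> in at t within {0..T}. \<tau> \<noteq> t"
    by (simp add: eventually_at_filter)
  ultimately show ?thesis
    by eventually_elim (auto intro: abs_diff_quotient_le_imp dest: C_norm_less_imp)
qed

lemma has_C1_derivative_C_imp_Linf_deriv:
  assumes "has_C1_derivative V C_norm T u u'" "t \<in> {0..T}"
  shows "Linf_deriv T u (u' t) t"
  unfolding Linf_deriv_def
proof (intro allI impI)
  fix \<epsilon> :: real assume "0 < \<epsilon>"
  from has_C1_derivative_C_eventually[OF assms this]
  show "\<forall>\<^sub>F \<tau> in at t within {0..T}. AE s in \<lambda>\<^sub>I. \<bar>u \<tau> s - u t s - (\<tau> - t) * u' t s\<bar> \<le> \<epsilon> * \<bar>\<tau> - t\<bar>"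
    by eventually_elim (auto intro!: AE_I2)
qed

text \<open>The scalar analogue of \<open>Linf_deriv\<close>, through which derivatives pass between
  single components and curves of functions.\<close>

lemma has_real_derivative_within_iff:
  fixes f :: "real \<Rightarrow> real"
  shows "(f has_real_derivative d) (at t within A) \<longleftrightarrow>
    (\<forall>\<epsilon>>0. \<forall>\<^sub>F \<tau> in at t within A. \<bar>f \<tau> - f t - (\<tau> - t) * d\<bar> \<le> \<epsilon> * \<bar>\<tau> - t\<bar>)"
  (is "_ \<longleftrightarrow> ?R")
proof
  have ne: "\<forall>\<^sub>F \<tau> in at t within A. \<tau> \<noteq> t"
    by (simp add: eventually_at_filter)
  {
    assume "(f has_real_derivative d) (at t within A)"
    then have *: "((\<lambda>\<tau>. (f \<tau> - f t) / (\<tau> - t)) \<longlongrightarrow> d) (at t within A)"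
      by (simp add: has_field_derivative_iff)
    show ?R
    proof (intro allI impI)
      fix \<epsilon> :: real assume "0 < \<epsilon>"
      from tendstoD[OF * this] ne
      show "\<forall>\<^sub>F \<tau> in at t within A. \<bar>f \<tau> - f t - (\<tau> - t) * d\<bar> \<le> \<epsilon> * \<bar>\<tau> - t\<bar>"
        by eventually_elim (auto intro!: abs_diff_quotient_le_imp simp: dist_real_def)
    qed
  }
  assume R: ?R
  have "((\<lambda>\<tau>. (f \<tau> - f t) / (\<tau> - t)) \<longlongrightarrow> d) (at t within A)"
  proof (rule tendstoI)
    fix \<epsilon> :: real assume "0 < \<epsilon>"
    then have "\<forall>\<^sub>F \<tau> in at t within A. \<bar>f \<tau> - f t - (\<tau> - t) * d\<bar> \<le> \<epsilon> / 2 * \<bar>\<tau> - t\<bar>"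
      using R half_gt_zero by blast
    with ne show "\<forall>\<^sub>F \<tau> in at t within A. dist ((f \<tau> - f t) / (\<tau> - t)) d < \<epsilon>"
    proof eventually_elim
      case (elim \<tau>)
      have "\<bar>(f \<tau> - f t) / (\<tau> - t) - d\<bar> * \<bar>\<tau> - t\<bar> = \<bar>f \<tau> - f t - (\<tau> - t) * d\<bar>"
        using elim(1) by (simp add: field_simps flip: abs_mult)
      also have "\<dots> \<le> \<epsilon> / 2 * \<bar>\<tau> - t\<bar>" by fact
      finally have "\<bar>(f \<tau> - f t) / (\<tau> - t) - d\<bar> \<le> \<epsilon> / 2"
        using elim(1) by simp
      with \<open>0 < \<epsilon>\<close> show ?case by (simp add: dist_real_def)
    qed
  qed
  then show "(f has_real_derivative d) (at t within A)"
    by (simp add: has_field_derivative_iff)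
qed

lemma has_C1_derivative_C_imp_has_real_derivative:
  assumes "has_C1_derivative V C_norm T u u'" "t \<in> {0..T}" "s \<in> \<I>"
  shows "((\<lambda>\<tau>. u \<tau> s) has_real_derivative u' t s) (at t within {0..T})"
  unfolding has_real_derivative_within_iff
proof (intro allI impI)
  fix \<epsilon> :: real assume "0 < \<epsilon>"
  from has_C1_derivative_C_eventually[OF assms(1,2) this]
  show "\<forall>\<^sub>F \<tau> in at t within {0..T}. \<bar>u \<tau> s - u t s - (\<tau> - t) * u' t s\<bar> \<le> \<epsilon> * \<bar>\<tau> - t\<bar>"
    by eventually_elim (use assms(3) in auto)
qed

text \<open>Phrased for a predicate because the intended bound holds almost everywhere, with a null
  set depending on \<open>t\<close>. The local hypothesis names \<open>t\<close> itself besides the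
  nearby times, since the filter \<open>at t within A\<close> omits \<open>t\<close>.\<close>

lemma compact_uniform_bound:
  fixes A :: "real set"
  assumes "compact A"
    and local: "\<And>t. t \<in> A \<Longrightarrow> \<exists>B. P t B \<and> (\<forall>\<^sub>F \<tau> in at t within A. P \<tau> B)"
    and mono: "\<And>t B B'. P t B \<Longrightarrow> B \<le> B' \<Longrightarrow> P t (B'::real)"
  shows "\<exists>B. \<forall>t\<in>A. P t B"
proof -
  have "\<exists>B U. open U \<and> t \<in> U \<and> (\<forall>\<tau>\<in>U \<inter> A. P \<tau> B)" if "t \<in> A" for t
    using local[OF that] unfolding eventually_at_topological by (metis IntD1 IntD2)
  then obtain B U where BU: "\<And>t. t \<in> A \<Longrightarrow> open (U t) \<and> t \<in> U t \<and> (\<forall>\<tau>\<in>U t \<inter> A. P \<tau> (B t))"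
    by metis
  obtain F where F: "F \<subseteq> A" "finite F" "A \<subseteq> (\<Union>t\<in>F. U t)"
    using compactE_image[OF \<open>compact A\<close>, of A U] BU by blast
  show ?thesis
  proof (intro exI ballI)
    fix t assume "t \<in> A"
    then obtain r where r: "r \<in> F" "t \<in> U r" using F by blast
    then have "P t (B r)" using BU F \<open>t \<in> A\<close> by blast
    moreover have "B r \<le> (\<Sum>r\<in>F. \<bar>B r\<bar>)"
      using member_le_sum[of r F "\<lambda>r. \<bar>B r\<bar>"] r F by (auto intro: order_trans[OF abs_ge_self])
    ultimately show "P t (\<Sum>r\<in>F. \<bar>B r\<bar>)" by (rule mono)
  qed
qed

section \<open>Essentially bounded functions and curves\<close>

lemma Linf_space_imp_bounded:
  assumes "f \<in> Linf_space"
  shows "\<exists>B. AE s in \<lambda>\<^sub>I. \<bar>f s\<bar> \<le> B"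
proof -
  have "Linf_norm f < \<infinity>" using assms by (simp add: Linf_space_def)
  then obtain B where "Linf_norm f < ereal B"
    using less_PInf_Ex_of_nat[of "Linf_norm f"] by auto
  then show ?thesis by (intro exI Linf_norm_less_imp_AE)
qed

lemma Linf_spaceI:
  assumes f [measurable]: "f \<in> borel_measurable \<lambda>\<^sub>I" and B: "AE s in \<lambda>\<^sub>I. \<bar>f s\<bar> \<le> B"
  shows "f \<in> Linf_space"
proof -
  have "Linf_norm f \<le> ereal B"
    unfolding Linf_norm_def using B by (intro esssup_I) auto
  then show ?thesis using f by (auto simp: Linf_space_def)
qed

lemma C_space_imp_Linf_space:
  assumes "f \<in> C_space"
  shows "f \<in> Linf_space"
proof -
  have f: "continuous_on \<I> f" using assms by (simp add: C_space_def)
  then have "bounded (f ` \<I>)"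
    by (intro compact_imp_bounded compact_continuous_image) auto
  then obtain B where "\<forall>s\<in>\<I>. \<bar>f s\<bar> \<le> B"
    unfolding bounded_iff by auto
  then show ?thesis
    using f by (intro Linf_spaceI[where B = B] AE_I2 continuous_imp_measurable_on_sets_lebesgue) auto
qed

lemma idx_in_Linf_space:
  assumes N: "1 \<le> N"
  shows "(\<lambda>s. f (idx N s)) \<in> Linf_space"
proof (rule Linf_spaceI)
  show "AE s in \<lambda>\<^sub>I. \<bar>f (idx N s)\<bar> \<le> (\<Sum>i=1..N. \<bar>f i\<bar>)"
    using idx_in_range[OF N] by (intro AE_I2 member_le_sum[of _ _ "\<lambda>i. \<bar>f i\<bar>"]) auto
qed measurable

lemma Linf_space_diff:
  assumes f: "f \<in> Linf_space" and g: "g \<in> Linf_space"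
  shows "(\<lambda>s. f s - g s) \<in> Linf_space"
proof -
  obtain B B' where "AE s in \<lambda>\<^sub>I. \<bar>f s\<bar> \<le> B" "AE s in \<lambda>\<^sub>I. \<bar>g s\<bar> \<le> B'"
    using Linf_space_imp_bounded[OF f] Linf_space_imp_bounded[OF g] by blast
  then have "AE s in \<lambda>\<^sub>I. \<bar>f s - g s\<bar> \<le> B + B'"
    by eventually_elim linarith
  moreover have "(\<lambda>s. f s - g s) \<in> borel_measurable \<lambda>\<^sub>I"
    using f g unfolding Linf_space_def by (intro borel_measurable_diff) blast+
  ultimately show ?thesis by (intro Linf_spaceI)
qed

lemma integrable_mult_Linf:
  assumes f: "f \<in> Linf_space" and g: "g \<in> Linf_space"
  shows "integrable \<lambda>\<^sub>I (\<lambda>s. f s * g s)"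
proof -
  obtain B B' where B: "AE s in \<lambda>\<^sub>I. \<bar>f s\<bar> \<le> B" "AE s in \<lambda>\<^sub>I. \<bar>g s\<bar> \<le> B'"
    using Linf_space_imp_bounded[OF f] Linf_space_imp_bounded[OF g] by blast
  show ?thesis
  proof (rule unit_ivl.integrable_const_bound)
    show "AE s in \<lambda>\<^sub>I. norm (f s * g s) \<le> B * B'"
      using B by eventually_elim (auto simp: abs_mult intro!: mult_mono)
    show "(\<lambda>s. f s * g s) \<in> borel_measurable \<lambda>\<^sub>I"
      using f g unfolding Linf_space_def by (intro borel_measurable_times) blast+
  qed
qed

text \<open>Differentiability bounds the curve near each time, and compactness makes these bounds
  uniform. Applied to the limit weights, this gives their a priori bound.\<close>

lemma has_C1_derivative_Linf_imp_bounded: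
  assumes u: "has_C1_derivative Linf_space Linf_norm T u u'"
  shows "\<exists>B. \<forall>t\<in>{0..T}. AE s in \<lambda>\<^sub>I. \<bar>u t s\<bar> \<le> B"
proof (rule compact_uniform_bound)
  fix t assume t: "t \<in> {0..T}"
  then have "u t \<in> Linf_space" "u' t \<in> Linf_space"
    using u by (auto simp: has_C1_derivative_def)
  then obtain B B' where B: "AE s in \<lambda>\<^sub>I. \<bar>u t s\<bar> \<le> B" "AE s in \<lambda>\<^sub>I. \<bar>u' t s\<bar> \<le> B'"
    using Linf_space_imp_bounded[of "u t"] Linf_space_imp_bounded[of "u' t"] by blast
  \<comment> \<open>Accuracy 1 for the remainder accounts for the summand 1 in
    \<open>T * (\<bar>B'\<bar> + 1)\<close> below; \<open>T\<close> bounds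
    \<open>\<bar>\<tau> - t\<bar>\<close>.\<close>
  have near: "\<forall>\<^sub>F \<tau> in at t within {0..T}. AE s in \<lambda>\<^sub>I. \<bar>u \<tau> s - u t s - (\<tau> - t) * u' t s\<bar> \<le> 1 * \<bar>\<tau> - t\<bar>"
    using has_C1_derivative_Linf_imp_Linf_deriv[OF u t] unfolding Linf_deriv_def by (simp only: zero_less_one)
  have "\<forall>\<^sub>F \<tau> in at t within {0..T}. \<tau> \<in> {0..T}"
    by (simp add: eventually_at_filter)
  with near have "\<forall>\<^sub>F \<tau> in at t within {0..T}. AE s in \<lambda>\<^sub>I. \<bar>u \<tau> s\<bar> \<le> B + T * (\<bar>B'\<bar> + 1)"
  proof eventually_elim
    case (elim \<tau>)
    then have T: "\<bar>\<tau> - t\<bar> \<le> T" using t by auto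
    from elim(1) B show ?case
    proof eventually_elim
      case (elim s)
      have "\<bar>(\<tau> - t) * u' t s\<bar> \<le> T * \<bar>B'\<bar>"
        unfolding abs_mult using T elim by (intro mult_mono) auto
      with elim T show ?case by (simp add: distrib_left)
    qed
  qed
  moreover have "AE s in \<lambda>\<^sub>I. \<bar>u t s\<bar> \<le> B + T * (\<bar>B'\<bar> + 1)"
    using B(1) by eventually_elim (use t in \<open>auto intro: add_increasing2\<close>)
  ultimately show "\<exists>B. (AE s in \<lambda>\<^sub>I. \<bar>u t s\<bar> \<le> B) \<and> (\<forall>\<^sub>F \<tau> in at t within {0..T}. AE s in \<lambda>\<^sub>I. \<bar>u \<tau> s\<bar> \<le> B)"
    by blast
next
  fix t B B' assume "AE s in \<lambda>\<^sub>I. \<bar>u t s\<bar> \<le> B" "B \<le> (B'::real)"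
  then show "AE s in \<lambda>\<^sub>I. \<bar>u t s\<bar> \<le> B'" by (auto elim: eventually_mono)
qed simp

text \<open>The remainder of the linear approximation is small uniformly off a null set, so
  expanding the square gives an integrand bound that can be integrated directly over a space of
  measure 1.\<close>

lemma has_real_derivative_integral_square:
  assumes deriv: "Linf_deriv T u v t" and t: "t \<in> {0..T}"
    and u: "\<And>\<tau>. \<tau> \<in> {0..T} \<Longrightarrow> u \<tau> \<in> Linf_space" and v: "v \<in> Linf_space"
  shows "((\<lambda>\<tau>. LINT s|\<lambda>\<^sub>I. (u \<tau> s)\<^sup>2) has_real_derivative 2 * (LINT s|\<lambda>\<^sub>I. u t s * v s)) (at t within {0..T})"
  unfolding has_real_derivative_within_iff
proof (intro allI impI)
  fix \<epsilon> :: real assume \<epsilon>: "0 < \<epsilon>"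
  have [measurable]: "v \<in> borel_measurable \<lambda>\<^sub>I" using v by (simp add: Linf_space_def)
  obtain B1 B2 where B12: "AE s in \<lambda>\<^sub>I. \<bar>u t s\<bar> \<le> B1" "AE s in \<lambda>\<^sub>I. \<bar>v s\<bar> \<le> B2"
    using Linf_space_imp_bounded[OF u[OF t]] Linf_space_imp_bounded[OF v] by blast
  define B where "B = max B1 B2"
  have B: "AE s in \<lambda>\<^sub>I. \<bar>u t s\<bar> \<le> B" "AE s in \<lambda>\<^sub>I. \<bar>v s\<bar> \<le> B"
    using B12 unfolding B_def by (auto elim: eventually_mono)
  have "AE s in \<lambda>\<^sub>I. 0 \<le> B"
    using B(1) by eventually_elim linarith
  then have "0 \<le> B" by simp
  have [measurable]: "u t \<in> borel_measurable \<lambda>\<^sub>I" using u t by (simp add: Linf_space_def)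
  \<comment> \<open>The part linear in the remainder needs
    \<open>2 * B * \<delta> \<le> \<epsilon> / 2\<close>; the cap 1 keeps the whole increment below
    \<open>\<bar>\<tau> - t\<bar> * (B + 1)\<close>, whose square is of second order.\<close>
  define \<delta> where "\<delta> = min 1 (\<epsilon> / (4 * (B + 1)))"
  have \<delta>: "0 < \<delta>" "\<delta> \<le> 1" "2 * B * \<delta> \<le> \<epsilon> / 2"
  proof -
    show "0 < \<delta>" "\<delta> \<le> 1" using \<epsilon> \<open>0 \<le> B\<close> by (auto simp: \<delta>_def)
    have "2 * B * \<delta> \<le> 2 * (B + 1) * (\<epsilon> / (4 * (B + 1)))"
      using \<open>0 \<le> B\<close> \<epsilon> by (intro mult_mono) (auto simp: \<delta>_def)
    also have "\<dots> = \<epsilon> / 2" using \<open>0 \<le> B\<close> by (simp add: field_simps)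
    finally show "2 * B * \<delta> \<le> \<epsilon> / 2" .
  qed
  have near: "\<forall>\<^sub>F \<tau> in at t within {0..T}. AE s in \<lambda>\<^sub>I. \<bar>u \<tau> s - u t s - (\<tau> - t) * v s\<bar> \<le> \<delta> * \<bar>\<tau> - t\<bar>"
    using deriv \<delta>(1) by (auto simp: Linf_deriv_def)
  have "((\<lambda>\<tau>. \<bar>\<tau> - t\<bar> * (B + 1)\<^sup>2) \<longlongrightarrow> \<bar>t - t\<bar> * (B + 1)\<^sup>2) (at t within {0..T})"
    by (intro tendsto_intros)
  then have small: "\<forall>\<^sub>F \<tau> in at t within {0..T}. \<bar>\<tau> - t\<bar> * (B + 1)\<^sup>2 < \<epsilon> / 2"
    using \<epsilon> by (intro order_tendstoD(2)) auto
  have "\<forall>\<^sub>F \<tau> in at t within {0..T}. \<tau> \<in> {0..T}"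
    by (simp add: eventually_at_filter)
  with near small show "\<forall>\<^sub>F \<tau> in at t within {0..T}. \<bar>(LINT s|\<lambda>\<^sub>I. (u \<tau> s)\<^sup>2) - (LINT s|\<lambda>\<^sub>I. (u t s)\<^sup>2)
      - (\<tau> - t) * (2 * (LINT s|\<lambda>\<^sub>I. u t s * v s))\<bar> \<le> \<epsilon> * \<bar>\<tau> - t\<bar>"
  proof eventually_elim
    case (elim \<tau>)
    let ?h = "\<tau> - t"
    have [measurable]: "u \<tau> \<in> borel_measurable \<lambda>\<^sub>I" using u elim by (simp add: Linf_space_def)
    have AE: "AE s in \<lambda>\<^sub>I. \<bar>(u \<tau> s)\<^sup>2 - (u t s)\<^sup>2 - 2 * ?h * (u t s * v s)\<bar> \<le> \<epsilon> * \<bar>?h\<bar>"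
      using elim(1) B
    proof eventually_elim
      case (elim s)
      let ?r = "u \<tau> s - u t s - ?h * v s"
      have "\<bar>?h * v s\<bar> \<le> \<bar>?h\<bar> * B"
        unfolding abs_mult by (intro mult_left_mono elim abs_ge_zero)
      moreover have "\<delta> * \<bar>?h\<bar> \<le> 1 * \<bar>?h\<bar>"
        using \<delta> by (intro mult_right_mono) auto
      ultimately have "\<bar>?h * v s\<bar> + \<bar>?r\<bar> \<le> \<bar>?h\<bar> * B + 1 * \<bar>?h\<bar>"
        by (intro add_mono order_trans[OF elim(1)])
      then have "\<bar>?h * v s + ?r\<bar> \<le> \<bar>?h\<bar> * (B + 1)"
        by (intro order_trans[OF abs_triangle_ineq]) (simp add: distrib_left)
      then have "\<bar>?h * v s + ?r\<bar>\<^sup>2 \<le> (\<bar>?h\<bar> * (B + 1))\<^sup>2"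
        by (intro power_mono) auto
      also have "\<dots> = (\<bar>?h\<bar> * (B + 1)\<^sup>2) * \<bar>?h\<bar>"
        by (simp add: power2_eq_square)
      also have "\<dots> \<le> \<epsilon> / 2 * \<bar>?h\<bar>"
        using \<open>\<bar>?h\<bar> * (B + 1)\<^sup>2 < \<epsilon> / 2\<close> by (intro mult_right_mono less_imp_le abs_ge_zero)
      finally have 1: "\<bar>(?h * v s + ?r)\<^sup>2\<bar> \<le> \<epsilon> / 2 * \<bar>?h\<bar>" by simp
      have "\<bar>2 * u t s * ?r\<bar> = 2 * \<bar>u t s\<bar> * \<bar>?r\<bar>"
        by (simp only: abs_mult abs_numeral)
      also have "\<dots> \<le> 2 * B * (\<delta> * \<bar>?h\<bar>)"
        by (intro mult_mono mult_nonneg_nonneg elim order_refl \<open>0 \<le> B\<close> abs_ge_zero zero_le_numeral)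
      also have "\<dots> = 2 * B * \<delta> * \<bar>?h\<bar>"
        by (simp only: mult.assoc)
      also have "\<dots> \<le> \<epsilon> / 2 * \<bar>?h\<bar>"
        by (intro mult_right_mono \<delta>(3) abs_ge_zero)
      finally have 2: "\<bar>2 * u t s * ?r\<bar> \<le> \<epsilon> / 2 * \<bar>?h\<bar>" .
      have "(u \<tau> s)\<^sup>2 - (u t s)\<^sup>2 - 2 * ?h * (u t s * v s) = 2 * u t s * ?r + (?h * v s + ?r)\<^sup>2"
        by (simp add: power2_eq_square algebra_simps)
      then have "\<bar>(u \<tau> s)\<^sup>2 - (u t s)\<^sup>2 - 2 * ?h * (u t s * v s)\<bar> \<le> \<bar>2 * u t s * ?r\<bar> + \<bar>(?h * v s + ?r)\<^sup>2\<bar>"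
        by (simp only: abs_triangle_ineq)
      also have "\<dots> \<le> \<epsilon> / 2 * \<bar>?h\<bar> + \<epsilon> / 2 * \<bar>?h\<bar>"
        by (intro add_mono 1 2)
      finally show ?case by simp
    qed
    have int_t: "integrable \<lambda>\<^sub>I (\<lambda>s. (u t s)\<^sup>2)"
    proof (rule unit_ivl.integrable_const_bound)
      show "AE s in \<lambda>\<^sub>I. norm ((u t s)\<^sup>2) \<le> B\<^sup>2"
        using B(1) by eventually_elim (use \<open>0 \<le> B\<close> in \<open>simp add: abs_le_square_iff[symmetric]\<close>)
    qed measurable
    have int_tv: "integrable \<lambda>\<^sub>I (\<lambda>s. u t s * v s)"
    proof (rule unit_ivl.integrable_const_bound)
      show "AE s in \<lambda>\<^sub>I. norm (u t s * v s) \<le> B * B"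
        using B by eventually_elim (use \<open>0 \<le> B\<close> in \<open>auto simp: abs_mult intro!: mult_mono\<close>)
    qed measurable
    have int_r: "integrable \<lambda>\<^sub>I (\<lambda>s. (u \<tau> s)\<^sup>2 - (u t s)\<^sup>2 - 2 * ?h * (u t s * v s))"
      using AE by (intro unit_ivl.integrable_const_bound[where B = "\<epsilon> * \<bar>?h\<bar>"]) auto
    \<comment> \<open>Adding back the terms at time \<open>t\<close> exhibits the square of
      \<open>u \<tau>\<close> as a sum of integrable functions.\<close>
    have "integrable \<lambda>\<^sub>I (\<lambda>s. ((u \<tau> s)\<^sup>2 - (u t s)\<^sup>2 - 2 * ?h * (u t s * v s)) + ((u t s)\<^sup>2 + 2 * ?h * (u t s * v s)))"
      by (intro Bochner_Integration.integrable_add int_r int_t integrable_mult_right int_tv)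
    then have int_\<tau>: "integrable \<lambda>\<^sub>I (\<lambda>s. (u \<tau> s)\<^sup>2)"
      by (rule back_subst[of "integrable \<lambda>\<^sub>I"]) (rule ext, argo)
    have "(LINT s|\<lambda>\<^sub>I. (u \<tau> s)\<^sup>2 - (u t s)\<^sup>2 - 2 * ?h * (u t s * v s))
      = (LINT s|\<lambda>\<^sub>I. (u \<tau> s)\<^sup>2) - (LINT s|\<lambda>\<^sub>I. (u t s)\<^sup>2) - 2 * ?h * (LINT s|\<lambda>\<^sub>I. u t s * v s)"
      by (simp only: Bochner_Integration.integral_diff[OF Bochner_Integration.integrable_diff[OF int_\<tau> int_t] integrable_mult_right[OF int_tv]]
          Bochner_Integration.integral_diff[OF int_\<tau> int_t] integral_mult_right_zero)
    then have "\<bar>(LINT s|\<lambda>\<^sub>I. (u \<tau> s)\<^sup>2) - (LINT s|\<lambda>\<^sub>I. (u t s)\<^sup>2) - ?h * (2 * (LINT s|\<lambda>\<^sub>I. u t s * v s))\<bar>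
      = \<bar>LINT s|\<lambda>\<^sub>I. (u \<tau> s)\<^sup>2 - (u t s)\<^sup>2 - 2 * ?h * (u t s * v s)\<bar>"
      by argo
    also have "\<dots> \<le> (LINT s|\<lambda>\<^sub>I. \<bar>(u \<tau> s)\<^sup>2 - (u t s)\<^sup>2 - 2 * ?h * (u t s * v s)\<bar>)"
      by (rule integral_abs_bound)
    also have "\<dots> \<le> (LINT s|\<lambda>\<^sub>I. \<epsilon> * \<bar>?h\<bar>)"
      by (intro integral_mono_AE Bochner_Integration.integrable_abs int_r AE unit_ivl.integrable_const)
    also have "\<dots> = \<epsilon> * \<bar>?h\<bar>"
      using unit_ivl.prob_space by simp
    finally show ?case .
  qed
qed

section \<open>The interaction functional\<close>

interpretation unit_sq: pair_prob_space "\<lambda>\<^sub>I" "\<lambda>\<^sub>I" ..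

lemma distr_fst_unit: "distr (\<lambda>\<^sub>I \<Otimes>\<^sub>M \<lambda>\<^sub>I) \<lambda>\<^sub>I fst = \<lambda>\<^sub>I"
  by (rule unit_ivl.distr_pair_fst)

lemma distr_snd_unit: "distr (\<lambda>\<^sub>I \<Otimes>\<^sub>M \<lambda>\<^sub>I) \<lambda>\<^sub>I snd = \<lambda>\<^sub>I"
  by (subst unit_sq.distr_pair_swap) (simp add: distr_distr comp_def case_prod_unfold distr_fst_unit)

text \<open>Both marginals of the product measure are \<open>\<lambda>\<^sub>I\<close>, so null sets
  of one variable pull back to null sets of the square.\<close>

lemma AE_pair_unit:
  assumes "AE s in \<lambda>\<^sub>I. P s"
  shows "AE z in \<lambda>\<^sub>I \<Otimes>\<^sub>M \<lambda>\<^sub>I. P (fst z)" "AE z in \<lambda>\<^sub>I \<Otimes>\<^sub>M \<lambda>\<^sub>I. P (snd z)"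
proof -
  from AE_distrD[of fst "\<lambda>\<^sub>I \<Otimes>\<^sub>M \<lambda>\<^sub>I" "\<lambda>\<^sub>I" P] AE_distrD[of snd "\<lambda>\<^sub>I \<Otimes>\<^sub>M \<lambda>\<^sub>I" "\<lambda>\<^sub>I" P] assms
  show "AE z in \<lambda>\<^sub>I \<Otimes>\<^sub>M \<lambda>\<^sub>I. P (fst z)" "AE z in \<lambda>\<^sub>I \<Otimes>\<^sub>M \<lambda>\<^sub>I. P (snd z)"
    unfolding distr_fst_unit distr_snd_unit by auto
qed

lemma
  fixes f :: "real \<Rightarrow> real"
  assumes "integrable \<lambda>\<^sub>I f"
  shows integrable_pair_unit: "integrable (\<lambda>\<^sub>I \<Otimes>\<^sub>M \<lambda>\<^sub>I) (\<lambda>z. f (fst z))" "integrable (\<lambda>\<^sub>I \<Otimes>\<^sub>M \<lambda>\<^sub>I) (\<lambda>z. f (snd z))"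
    and integral_pair_unit: "(LINT z|(\<lambda>\<^sub>I \<Otimes>\<^sub>M \<lambda>\<^sub>I). f (fst z)) = (LINT s|\<lambda>\<^sub>I. f s)"
      "(LINT z|(\<lambda>\<^sub>I \<Otimes>\<^sub>M \<lambda>\<^sub>I). f (snd z)) = (LINT s|\<lambda>\<^sub>I. f s)"
proof -
  have f: "f \<in> borel_measurable \<lambda>\<^sub>I" using assms by auto
  show "integrable (\<lambda>\<^sub>I \<Otimes>\<^sub>M \<lambda>\<^sub>I) (\<lambda>z. f (fst z))" "integrable (\<lambda>\<^sub>I \<Otimes>\<^sub>M \<lambda>\<^sub>I) (\<lambda>z. f (snd z))"
    using integrable_distr[of fst "\<lambda>\<^sub>I \<Otimes>\<^sub>M \<lambda>\<^sub>I" "\<lambda>\<^sub>I" f]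
      integrable_distr[of snd "\<lambda>\<^sub>I \<Otimes>\<^sub>M \<lambda>\<^sub>I" "\<lambda>\<^sub>I" f] assms
    by (simp_all add: distr_fst_unit distr_snd_unit)
  show "(LINT z|(\<lambda>\<^sub>I \<Otimes>\<^sub>M \<lambda>\<^sub>I). f (fst z)) = (LINT s|\<lambda>\<^sub>I. f s)"
    "(LINT z|(\<lambda>\<^sub>I \<Otimes>\<^sub>M \<lambda>\<^sub>I). f (snd z)) = (LINT s|\<lambda>\<^sub>I. f s)"
    using integral_distr[of fst "\<lambda>\<^sub>I \<Otimes>\<^sub>M \<lambda>\<^sub>I" "\<lambda>\<^sub>I" f]
      integral_distr[of snd "\<lambda>\<^sub>I \<Otimes>\<^sub>M \<lambda>\<^sub>I" "\<lambda>\<^sub>I" f] f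
    by (simp_all add: distr_fst_unit distr_snd_unit)
qed

lemma finite_abs_bound:
  fixes f :: "nat \<Rightarrow> real"
  shows "\<exists>B. \<forall>i\<in>{1..N}. \<bar>f i\<bar> \<le> B"
  by (intro exI[of _ "\<Sum>i=1..N. \<bar>f i\<bar>"] ballI member_le_sum) auto

text \<open>\<open>C\<close> may be any Lipschitz constant of \<open>a\<close>, not only the least
  one. The two Lipschitz conditions on \<open>\<sigma>\<close> are kept apart because no such bound
  holds across a jump at 0.\<close>

locale opinion_kernel =
  fixes a \<sigma> :: "real \<Rightarrow> real" and C S S_inf :: real
  assumes a_lipschitz: "\<bar>a u - a v\<bar> \<le> C * \<bar>u - v\<bar>"
    and a_zero: "a 0 = 0"
    and \<sigma>_odd: "\<sigma> (- u) = - \<sigma> u"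
    and \<sigma>_bounded: "\<bar>\<sigma> u\<bar> \<le> S_inf"
    and \<sigma>_lipschitz_pos: "0 < u \<Longrightarrow> 0 < v \<Longrightarrow> \<bar>\<sigma> u - \<sigma> v\<bar> \<le> S * \<bar>u - v\<bar>"
    and \<sigma>_lipschitz_neg: "u < 0 \<Longrightarrow> v < 0 \<Longrightarrow> \<bar>\<sigma> u - \<sigma> v\<bar> \<le> S * \<bar>u - v\<bar>"
begin

lemma C_nonneg: "0 \<le> C"
  using a_lipschitz[of 1 0] by simp

lemma S_nonneg: "0 \<le> S"
  using \<sigma>_lipschitz_pos[of 1 2] by simp

lemma S_inf_nonneg: "0 \<le> S_inf"
  using \<sigma>_bounded[of 0] by simp

lemma \<sigma>_zero [simp]: "\<sigma> 0 = 0"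
  using \<sigma>_odd[of 0] by simp

text \<open>A positive product expresses equal nonzero signs, which is the form in which
  preservation of order is delivered later.\<close>

lemma \<sigma>_lipschitz: "0 < u * v \<Longrightarrow> \<bar>\<sigma> u - \<sigma> v\<bar> \<le> S * \<bar>u - v\<bar>"
  using \<sigma>_lipschitz_pos[of u v] \<sigma>_lipschitz_neg[of u v] by (auto simp: zero_less_mult_iff)

lemma a_bounded: "\<bar>u\<bar> \<le> D \<Longrightarrow> \<bar>a u\<bar> \<le> C * D"
  using a_lipschitz[of u 0] C_nonneg by (auto simp: a_zero intro: order_trans mult_left_mono)

lemma a_measurable [measurable]: "a \<in> borel_measurable borel"
proof -
  have "C-lipschitz_on UNIV a"
    using a_lipschitz C_nonneg by (auto simp: lipschitz_on_def dist_real_def)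
  then show ?thesis
    by (intro borel_measurable_continuous_onI lipschitz_on_continuous_on)
qed

lemma \<sigma>_measurable [measurable]: "\<sigma> \<in> borel_measurable borel"
proof (rule borel_measurable_continuous_countable_exceptions[of "{0}"])
  have "S-lipschitz_on {0<..} \<sigma>" "S-lipschitz_on {..<0} \<sigma>"
    using \<sigma>_lipschitz_pos \<sigma>_lipschitz_neg S_nonneg by (auto simp: lipschitz_on_def dist_real_def)
  then have "continuous_on ({0<..} \<union> {..<0}) \<sigma>"
    by (intro continuous_on_open_Un lipschitz_on_continuous_on) auto
  also have "{0<..} \<union> {..<0} = - {0::real}" by auto
  finally show "continuous_on (- {0}) \<sigma>" .
qed simp

text \<open>The integrand of \<open>Psi\<close> without the outer factor \<open>m s\<close>.
  Splitting that factor off shows the weight equation as linear in \<open>m s\<close> with a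
  coefficient given by an integral.\<close>

definition weight :: "(real \<Rightarrow> real) \<Rightarrow> (real \<Rightarrow> real) \<Rightarrow> real \<Rightarrow> real \<times> real \<Rightarrow> real"
  where "weight x m s z = m (fst z) * m (snd z) * (a (x (snd z) - x s) + a (x (snd z) - x (fst z))) * \<sigma> (x s - x (fst z))"

lemma Psi_eq_weight: "Psi a \<sigma> s x m = m s * (LINT z|(\<lambda>\<^sub>I \<Otimes>\<^sub>M \<lambda>\<^sub>I). weight x m s z)"
  by (simp add: Psi_def weight_def case_prod_unfold)

lemma weight_measurable [measurable]:
  assumes [measurable]: "x \<in> borel_measurable \<lambda>\<^sub>I" "m \<in> borel_measurable \<lambda>\<^sub>I"
  shows "weight x m s \<in> borel_measurable (\<lambda>\<^sub>I \<Otimes>\<^sub>M \<lambda>\<^sub>I)"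
  unfolding weight_def[abs_def] by measurable

lemma Psi_measurable [measurable]:
  assumes [measurable]: "x \<in> borel_measurable \<lambda>\<^sub>I" "m \<in> borel_measurable \<lambda>\<^sub>I"
  shows "(\<lambda>s. Psi a \<sigma> s x m) \<in> borel_measurable \<lambda>\<^sub>I"
proof -
  have "(\<lambda>(s, z). weight x m s z) \<in> borel_measurable (\<lambda>\<^sub>I \<Otimes>\<^sub>M (\<lambda>\<^sub>I \<Otimes>\<^sub>M \<lambda>\<^sub>I))"
    unfolding weight_def by measurable
  from unit_sq.P.borel_measurable_lebesgue_integral[OF this] show ?thesis
    unfolding Psi_eq_weight by measurable
qed

text \<open>\<open>Psi\<close> depends on its arguments through integrals, which ignore null sets,
  and through their values at \<open>s\<close>, which must agree exactly; hence the two kinds of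
  hypotheses.\<close>

lemma Psi_cong_AE:
  assumes [measurable]: "x \<in> borel_measurable \<lambda>\<^sub>I" "m \<in> borel_measurable \<lambda>\<^sub>I" "y \<in> borel_measurable \<lambda>\<^sub>I" "n \<in> borel_measurable \<lambda>\<^sub>I"
    and AE: "AE s in \<lambda>\<^sub>I. x s = y s" "AE s in \<lambda>\<^sub>I. m s = n s" and s: "x s = y s" "m s = n s"
  shows "Psi a \<sigma> s x m = Psi a \<sigma> s y n"
proof -
  have "(LINT z|(\<lambda>\<^sub>I \<Otimes>\<^sub>M \<lambda>\<^sub>I). weight x m s z) = (LINT z|(\<lambda>\<^sub>I \<Otimes>\<^sub>M \<lambda>\<^sub>I). weight y n s z)"
  proof (rule integral_cong_AE)
    show "AE z in \<lambda>\<^sub>I \<Otimes>\<^sub>M \<lambda>\<^sub>I. weight x m s z = weight y n s z"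
      using AE_pair_unit[OF AE(1)] AE_pair_unit[OF AE(2)]
      by eventually_elim (simp add: weight_def s)
  qed measurable
  then show ?thesis by (simp add: Psi_eq_weight s)
qed

lemma abs_weight_le:
  assumes "\<bar>m (fst z)\<bar> \<le> B" "\<bar>m (snd z)\<bar> \<le> B" "\<bar>x (snd z) - x s\<bar> \<le> D" "\<bar>x (snd z) - x (fst z)\<bar> \<le> D"
  shows "\<bar>weight x m s z\<bar> \<le> B * B * (2 * (C * D)) * S_inf"
proof -
  have "\<bar>a (x (snd z) - x s) + a (x (snd z) - x (fst z))\<bar> \<le> 2 * (C * D)"
    using a_bounded[OF assms(3)] a_bounded[OF assms(4)] by linarith
  moreover have "0 \<le> B" "0 \<le> D" using assms by linarith+
  ultimately show ?thesis
    unfolding weight_def abs_mult using assms \<sigma>_bounded C_nonneg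
    by (intro mult_mono) auto
qed

lemma integrable_weight:
  assumes [measurable]: "x \<in> borel_measurable \<lambda>\<^sub>I" "m \<in> borel_measurable \<lambda>\<^sub>I"
    and m: "AE s in \<lambda>\<^sub>I. \<bar>m s\<bar> \<le> B" and x: "\<And>s s'. s \<in> \<I> \<Longrightarrow> s' \<in> \<I> \<Longrightarrow> \<bar>x s - x s'\<bar> \<le> D" and s: "s \<in> \<I>"
  shows "integrable (\<lambda>\<^sub>I \<Otimes>\<^sub>M \<lambda>\<^sub>I) (weight x m s)"
    and "\<bar>LINT z|(\<lambda>\<^sub>I \<Otimes>\<^sub>M \<lambda>\<^sub>I). weight x m s z\<bar> \<le> B * B * (2 * (C * D)) * S_inf"
proof -
  have AE: "AE z in \<lambda>\<^sub>I \<Otimes>\<^sub>M \<lambda>\<^sub>I. \<bar>weight x m s z\<bar> \<le> B * B * (2 * (C * D)) * S_inf"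
    using AE_pair_unit[OF m] AE_space
    by eventually_elim (auto intro!: abs_weight_le x s simp: space_pair_measure)
  show int: "integrable (\<lambda>\<^sub>I \<Otimes>\<^sub>M \<lambda>\<^sub>I) (weight x m s)"
    using AE by (intro unit_sq.P.integrable_const_bound) auto
  have "\<bar>LINT z|(\<lambda>\<^sub>I \<Otimes>\<^sub>M \<lambda>\<^sub>I). weight x m s z\<bar> \<le> (LINT z|(\<lambda>\<^sub>I \<Otimes>\<^sub>M \<lambda>\<^sub>I). \<bar>weight x m s z\<bar>)"
    by (rule integral_abs_bound)
  also have "\<dots> \<le> (LINT z|(\<lambda>\<^sub>I \<Otimes>\<^sub>M \<lambda>\<^sub>I). B * B * (2 * (C * D)) * S_inf)"
    using AE int by (intro integral_mono_AE) auto
  also have "\<dots> = B * B * (2 * (C * D)) * S_inf"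
    using unit_sq.P.prob_space by simp
  finally show "\<bar>LINT z|(\<lambda>\<^sub>I \<Otimes>\<^sub>M \<lambda>\<^sub>I). weight x m s z\<bar> \<le> B * B * (2 * (C * D)) * S_inf" .
qed

text \<open>The relative growth rate of the \<open>i\<close>-th weight. Each sum carries its own
  division by \<open>N\<close>, so that it matches an iterated integral over
  \<open>\<I>\<close>.\<close>

definition growth :: "nat \<Rightarrow> (nat \<Rightarrow> real) \<Rightarrow> (nat \<Rightarrow> real) \<Rightarrow> nat \<Rightarrow> real"
  where "growth N v w i = (\<Sum>j=1..N. (\<Sum>k=1..N. w j * w k * (a (v k - v i) + a (v k - v j)) * \<sigma> (v i - v j)) / real N) / real N"

text \<open>Fubini reduces the double integral to two applications of \<open>integral_idx\<close>.
  Thanks to \<open>idx\<close> the identity holds at every point of \<open>\<I>\<close>.\<close>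

lemma Psi_idx:
  assumes N: "1 \<le> N" and s: "s \<in> \<I>"
  shows "Psi a \<sigma> s (\<lambda>s. v (idx N s)) (\<lambda>s. w (idx N s)) = w (idx N s) * growth N v w (idx N s)"
proof -
  obtain B where B: "\<forall>i\<in>{1..N}. \<bar>w i\<bar> \<le> B" using finite_abs_bound by blast
  obtain D where D: "\<forall>i\<in>{1..N}. \<bar>v i\<bar> \<le> D" using finite_abs_bound by blast
  have v: "\<bar>v (idx N r) - v (idx N r')\<bar> \<le> 2 * D" if "r \<in> \<I>" "r' \<in> \<I>" for r r'
    using D idx_in_range[OF N that(1)] idx_in_range[OF N that(2)]
    by (smt (verit, best))
  have "integrable (\<lambda>\<^sub>I \<Otimes>\<^sub>M \<lambda>\<^sub>I) (weight (\<lambda>s. v (idx N s)) (\<lambda>s. w (idx N s)) s)"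
    using B v s idx_in_range[OF N] by (intro integrable_weight(1)[where B = B and D = "2 * D"]) auto
  from unit_sq.integral_fst'[OF this]
  have "(LINT z|(\<lambda>\<^sub>I \<Otimes>\<^sub>M \<lambda>\<^sub>I). weight (\<lambda>s. v (idx N s)) (\<lambda>s. w (idx N s)) s z)
    = (LINT s1|\<lambda>\<^sub>I. LINT s2|\<lambda>\<^sub>I. weight (\<lambda>s. v (idx N s)) (\<lambda>s. w (idx N s)) s (s1, s2))"
    by simp
  also have "\<dots> = (LINT s1|\<lambda>\<^sub>I. (\<lambda>j. (\<Sum>k=1..N. w j * w k * (a (v k - v (idx N s)) + a (v k - v j)) * \<sigma> (v (idx N s) - v j)) / real N) (idx N s1))"
    unfolding weight_def fst_conv snd_conv by (subst integral_idx[OF N, symmetric]) simp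
  also have "\<dots> = growth N v w (idx N s)"
    unfolding growth_def by (rule integral_idx[OF N])
  finally show ?thesis by (simp add: Psi_eq_weight)
qed

lemma AE_Psi_step:
  assumes N: "1 \<le> N"
  shows "AE s in \<lambda>\<^sub>I. Psi a \<sigma> s (step_fun N v) (step_fun N w) = w (idx N s) * growth N v w (idx N s)"
  using AE_step_fun_eq[OF N] AE_space
proof eventually_elim
  case (elim s)
  have "Psi a \<sigma> s (step_fun N v) (step_fun N w) = Psi a \<sigma> s (\<lambda>s. v (idx N s)) (\<lambda>s. w (idx N s))"
    using AE_step_fun_eq[OF N] elim by (intro Psi_cong_AE) auto
  with Psi_idx[OF N] elim show ?case by simp
qed

text \<open>On a cell the averaged function is almost everywhere constant, so averaging has no
  effect. This is why the step functions satisfy the limit equation without a discretization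
  error.\<close>

lemma psi_N_eq:
  assumes i: "i \<in> {1..N}"
  shows "psi_N a \<sigma> N i v w = w i * growth N v w i"
proof -
  have N: "1 \<le> N" using i by simp
  have "(LINT s|\<lambda>\<^sub>I. indicator (cell N i) s * Psi a \<sigma> s (step_fun N v) (step_fun N w))
    = (LINT s|\<lambda>\<^sub>I. indicator (cell N i) s * (w i * growth N v w i))"
  proof (rule Bochner_Integration.integral_cong_AE)
    show ae: "AE s in \<lambda>\<^sub>I. indicator (cell N i) s * Psi a \<sigma> s (step_fun N v) (step_fun N w) = indicator (cell N i) s * (w i * growth N v w i)"
      using AE_Psi_step[OF N, of v w] AE_idx_eq_if_in_cell[OF N]
      by eventually_elim (use i in \<open>auto split: split_indicator\<close>)
  qed (use i cell_sets_unit in measurable)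
  also have "\<dots> = measure \<lambda>\<^sub>I (cell N i) * (w i * growth N v w i)"
    using cell_subset[OF i] by (simp add: Int_absorb1 Int_absorb2)
  finally show ?thesis
    using i by (simp add: psi_N_def cell_avg_eq measure_cell)
qed

end

section \<open>Stability of the vector field\<close>

text \<open>Telescoping: one factor is exchanged at a time, and the three others are bounded by
  \<open>Q\<close>.\<close>

lemma abs_prod4_diff_le:
  fixes p1 p2 p3 p4 q1 q2 q3 q4 Q :: real
  assumes "\<bar>p1\<bar> \<le> Q" "\<bar>p2\<bar> \<le> Q" "\<bar>p3\<bar> \<le> Q" "\<bar>p4\<bar> \<le> Q" "\<bar>q1\<bar> \<le> Q" "\<bar>q2\<bar> \<le> Q" "\<bar>q3\<bar> \<le> Q" "\<bar>q4\<bar> \<le> Q"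
  shows "\<bar>p1 * p2 * p3 * p4 - q1 * q2 * q3 * q4\<bar> \<le> Q ^ 3 * (\<bar>p1 - q1\<bar> + \<bar>p2 - q2\<bar> + \<bar>p3 - q3\<bar> + \<bar>p4 - q4\<bar>)"
proof -
  have *: "\<bar>d * (p * q * r)\<bar> \<le> \<bar>d\<bar> * (Q * Q * Q)" if "\<bar>p\<bar> \<le> Q" "\<bar>q\<bar> \<le> Q" "\<bar>r\<bar> \<le> Q" for d p q r
  proof -
    have "0 \<le> Q" using that(1) by linarith
    with that show ?thesis
      unfolding abs_mult by (intro mult_mono mult_nonneg_nonneg abs_ge_zero order_refl)
  qed
  have "\<bar>p1 * p2 * p3 * p4 - q1 * q2 * q3 * q4\<bar> = \<bar>(p1 - q1) * (p2 * p3 * p4) + (p2 - q2) * (q1 * p3 * p4)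
      + (p3 - q3) * (q1 * q2 * p4) + (p4 - q4) * (q1 * q2 * q3)\<bar>"
    by (simp add: algebra_simps)
  also have "\<dots> \<le> \<bar>p1 - q1\<bar> * (Q * Q * Q) + \<bar>p2 - q2\<bar> * (Q * Q * Q) + \<bar>p3 - q3\<bar> * (Q * Q * Q) + \<bar>p4 - q4\<bar> * (Q * Q * Q)"
    by (intro order_trans[OF abs_triangle_ineq] add_mono * assms)
  also have "\<dots> = Q ^ 3 * (\<bar>p1 - q1\<bar> + \<bar>p2 - q2\<bar> + \<bar>p3 - q3\<bar> + \<bar>p4 - q4\<bar>)"
    by (simp add: power3_eq_cube algebra_simps)
  finally show ?thesis .
qed

lemma abs_sum_prod_le:
  fixes p q r s :: real
  shows "\<bar>p * q + r * s\<bar> \<le> \<bar>p\<bar> * \<bar>q\<bar> + \<bar>r\<bar> * \<bar>s\<bar>"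
  using abs_triangle_ineq[of "p * q" "r * s"] by (simp add: abs_mult)

text \<open>The difference of the two sides is the variance of \<open>f\<close> on the probability
  space \<open>\<I>\<close>.\<close>

lemma integral_square_le:
  fixes f :: "real \<Rightarrow> real"
  assumes "integrable \<lambda>\<^sub>I f" "integrable \<lambda>\<^sub>I (\<lambda>s. (f s)\<^sup>2)"
  shows "(LINT s|\<lambda>\<^sub>I. f s)\<^sup>2 \<le> (LINT s|\<lambda>\<^sub>I. (f s)\<^sup>2)"
  using unit_ivl.variance_eq[OF assms] unit_ivl.variance_positive[of f] by simp

text \<open>A snapshot at one time: \<open>v\<close>, \<open>w\<close> are the states of the finite
  system, \<open>x\<close>, \<open>m\<close> those of the limit. \<open>K\<close> and
  \<open>D\<close> bound both, and \<open>same_order\<close> keeps the arguments of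
  \<open>\<sigma>\<close> on one side of the jump.\<close>

locale kernel_comparison = opinion_kernel +
  fixes N :: nat and v w :: "nat \<Rightarrow> real" and x m :: "real \<Rightarrow> real" and K D :: real
  assumes N: "1 \<le> N"
    and x_measurable [measurable]: "x \<in> borel_measurable \<lambda>\<^sub>I"
    and m_measurable [measurable]: "m \<in> borel_measurable \<lambda>\<^sub>I"
    and m_bounded: "AE s in \<lambda>\<^sub>I. \<bar>m s\<bar> \<le> K"
    and x_spread: "s \<in> \<I> \<Longrightarrow> s' \<in> \<I> \<Longrightarrow> \<bar>x s - x s'\<bar> \<le> D"
    and w_bounded: "i \<in> {1..N} \<Longrightarrow> \<bar>w i\<bar> \<le> K"
    and v_spread: "i \<in> {1..N} \<Longrightarrow> j \<in> {1..N} \<Longrightarrow> \<bar>v i - v j\<bar> \<le> D"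
    and same_order: "s \<in> \<I> \<Longrightarrow> s' \<in> \<I> \<Longrightarrow> idx N s \<noteq> idx N s' \<Longrightarrow> 0 < (v (idx N s) - v (idx N s')) * (x s - x s')"
begin

abbreviation "y \<equiv> \<lambda>s. v (idx N s)"
abbreviation "n \<equiv> \<lambda>s. w (idx N s)"

text \<open>One bound for all four factors of \<open>weight\<close>: two weights, the sum of two
  values of \<open>a\<close>, and a value of \<open>\<sigma>\<close>.\<close>

definition "Q = K + 2 * (C * D) + S_inf"
text \<open>Collects the constants of both equations. The first two summands come from
  \<open>Psi_diff_le\<close>, where \<open>Q ^ 3 * (1 + 2 * C + S + 2 * Q)\<close> is the constant
  of \<open>weight_diff_le\<close>; the others cover \<open>drift_diff_le\<close>.\<close>

definition "\<Lambda> = Q ^ 4 + 2 * Q * (Q ^ 3 * (1 + 2 * C + S + 2 * Q)) + Q + Q * C + C * D"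
definition "err s = \<bar>y s - x s\<bar> + \<bar>n s - m s\<bar>"

lemma K_nonneg: "0 \<le> K"
  using w_bounded[of 1] N by auto

lemma D_nonneg: "0 \<le> D"
  using v_spread[of 1 1] N by auto

lemma bounds_le_Q: "K \<le> Q" "2 * (C * D) \<le> Q" "S_inf \<le> Q" "0 \<le> Q"
  using K_nonneg D_nonneg C_nonneg S_inf_nonneg by (auto simp: Q_def)

lemma y_spread: "s \<in> \<I> \<Longrightarrow> s' \<in> \<I> \<Longrightarrow> \<bar>y s - y s'\<bar> \<le> D"
  by (intro v_spread idx_in_range N)

lemma n_bounded: "s \<in> \<I> \<Longrightarrow> \<bar>n s\<bar> \<le> K"
  by (intro w_bounded idx_in_range N)

lemma err_nonneg: "0 \<le> err s"
  by (simp add: err_def)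

lemma err_ge: "\<bar>y s - x s\<bar> \<le> err s" "\<bar>n s - m s\<bar> \<le> err s"
  by (simp_all add: err_def)

lemma err_measurable [measurable]: "err \<in> borel_measurable \<lambda>\<^sub>I"
  unfolding err_def[abs_def] by measurable

text \<open>Only differences of opinions are controlled, so the values at 0 serve as anchors. The
  bound is used for integrability alone and never enters the constants.\<close>

lemma err_bounded: "AE s in \<lambda>\<^sub>I. err s \<le> \<bar>y 0\<bar> + \<bar>x 0\<bar> + 2 * D + 2 * K"
  using m_bounded AE_space
proof eventually_elim
  case (elim s)
  then have "\<bar>x s - x 0\<bar> \<le> D" "\<bar>y s - y 0\<bar> \<le> D" "\<bar>n s\<bar> \<le> K"
    using x_spread[of s 0] y_spread[of s 0] n_bounded[of s] by simp_all
  moreover have "\<bar>y s - x s\<bar> \<le> \<bar>y 0\<bar> + \<bar>x 0\<bar> + \<bar>x s - x 0\<bar> + \<bar>y s - y 0\<bar>" by linarith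
  moreover have "\<bar>n s - m s\<bar> \<le> \<bar>n s\<bar> + \<bar>m s\<bar>" by linarith
  ultimately show ?case
    using elim(1) by (simp add: err_def)
qed

lemma integrable_err: "integrable \<lambda>\<^sub>I err"
  using err_bounded err_nonneg by (intro unit_ivl.integrable_const_bound) auto

lemma integrable_err_square: "integrable \<lambda>\<^sub>I (\<lambda>s. (err s)\<^sup>2)"
proof (rule unit_ivl.integrable_const_bound)
  show "AE s in \<lambda>\<^sub>I. norm ((err s)\<^sup>2) \<le> (\<bar>y 0\<bar> + \<bar>x 0\<bar> + 2 * D + 2 * K)\<^sup>2"
    using err_bounded by eventually_elim (auto intro!: power_mono err_nonneg)
qed measurable

lemma a_sum_le_Q:
  assumes "\<bar>u\<bar> \<le> D" "\<bar>u'\<bar> \<le> D"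
  shows "\<bar>a u + a u'\<bar> \<le> Q"
  using a_bounded[OF assms(1)] a_bounded[OF assms(2)] bounds_le_Q(2) by linarith

lemma sigma_diff_le:
  assumes "s \<in> \<I>" "s1 \<in> \<I>"
  shows "\<bar>\<sigma> (y s - y s1) - \<sigma> (x s - x s1)\<bar> \<le> S * (err s + err s1) + 2 * Q * indicator (cell N (idx N s)) s1"
proof (cases "idx N s = idx N s1")
  case True
  then have "s1 \<in> cell N (idx N s)"
    using idx_in_cell[OF N assms(2)] by simp
  moreover have "\<bar>\<sigma> (y s - y s1) - \<sigma> (x s - x s1)\<bar> \<le> 2 * Q"
    using \<sigma>_bounded[of "y s - y s1"] \<sigma>_bounded[of "x s - x s1"] bounds_le_Q(3) by linarith
  moreover have "0 \<le> S * (err s + err s1)"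
    using S_nonneg err_nonneg by (intro mult_nonneg_nonneg add_nonneg_nonneg)
  ultimately show ?thesis by simp
next
  case False
  have "\<bar>\<sigma> (y s - y s1) - \<sigma> (x s - x s1)\<bar> \<le> S * \<bar>(y s - y s1) - (x s - x s1)\<bar>"
    using same_order[OF assms False] by (rule \<sigma>_lipschitz)
  also have "\<dots> \<le> S * (err s + err s1)"
    using S_nonneg err_ge(1)[of s] err_ge(1)[of s1] by (intro mult_left_mono) linarith+
  also have "\<dots> \<le> S * (err s + err s1) + 2 * Q * indicator (cell N (idx N s)) s1"
    using bounds_le_Q by simp
  finally show ?thesis .
qed

text \<open>In the sum \<open>1 + 2 * C + S + 2 * Q\<close> the 1 stems from the two weights,
  \<open>2 * C\<close> from the two values of \<open>a\<close>, and \<open>S + 2 * Q\<close> from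
  \<open>\<sigma>\<close>.\<close>

lemma weight_diff_le:
  assumes I: "s \<in> \<I>" "fst z \<in> \<I>" "snd z \<in> \<I>" and m: "\<bar>m (fst z)\<bar> \<le> K" "\<bar>m (snd z)\<bar> \<le> K"
  shows "\<bar>weight y n s z - weight x m s z\<bar> \<le> Q ^ 3 * (1 + 2 * C + S + 2 * Q) *
    (err s + err (fst z) + err (snd z) + indicator (cell N (idx N s)) (fst z))"
proof -
  obtain s1 s2 where z: "z = (s1, s2)" by fastforce
  let ?\<chi> = "indicator (cell N (idx N s)) s1 :: real"
  let ?a = "a (y s2 - y s) + a (y s2 - y s1)" and ?b = "a (x s2 - x s) + a (x s2 - x s1)"
  have \<chi>: "0 \<le> ?\<chi>" by simp
  have ab: "\<bar>?a - ?b\<bar> \<le> 2 * C * (err s + err s1 + err s2 + ?\<chi>)"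
  proof -
    have "\<bar>?a - ?b\<bar> \<le> C * \<bar>(y s2 - y s) - (x s2 - x s)\<bar> + C * \<bar>(y s2 - y s1) - (x s2 - x s1)\<bar>"
      using a_lipschitz[of "y s2 - y s" "x s2 - x s"] a_lipschitz[of "y s2 - y s1" "x s2 - x s1"]
      by linarith
    also have "\<dots> \<le> C * (err s + err s1 + err s2 + ?\<chi>) + C * (err s + err s1 + err s2 + ?\<chi>)"
    proof -
      have "\<bar>(y s2 - y r) - (x s2 - x r)\<bar> \<le> err r + err s2" for r
        using err_ge(1)[of s2] err_ge(1)[of r] by linarith
      from this[of s] this[of s1] err_nonneg[of s] err_nonneg[of s1] \<chi>
      show ?thesis using C_nonneg by (intro add_mono mult_left_mono) linarith+
    qed
    finally show ?thesis by simp
  qed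
  have \<sigma>: "\<bar>\<sigma> (y s - y s1) - \<sigma> (x s - x s1)\<bar> \<le> (S + 2 * Q) * (err s + err s1 + err s2 + ?\<chi>)"
  proof -
    have "\<bar>\<sigma> (y s - y s1) - \<sigma> (x s - x s1)\<bar> \<le> S * (err s + err s1) + 2 * Q * ?\<chi>"
      using sigma_diff_le[of s s1] I z by simp
    also have "\<dots> \<le> S * (err s + err s1 + err s2 + ?\<chi>) + 2 * Q * (err s + err s1 + err s2 + ?\<chi>)"
      using S_nonneg bounds_le_Q err_nonneg[of s] err_nonneg[of s1] err_nonneg[of s2]
      by (intro add_mono[OF mult_left_mono mult_left_mono]) auto
    finally show ?thesis by (simp add: algebra_simps)
  qed
  have nm: "\<bar>n s1 - m s1\<bar> + \<bar>n s2 - m s2\<bar> \<le> err s + err s1 + err s2 + ?\<chi>"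
    using err_ge(2)[of s1] err_ge(2)[of s2] err_nonneg[of s] \<chi> by linarith
  have "\<bar>weight y n s z - weight x m s z\<bar> \<le> Q ^ 3 *
      (\<bar>n s1 - m s1\<bar> + \<bar>n s2 - m s2\<bar> + \<bar>?a - ?b\<bar> + \<bar>\<sigma> (y s - y s1) - \<sigma> (x s - x s1)\<bar>)"
    unfolding weight_def z fst_conv snd_conv
  proof (intro abs_prod4_diff_le a_sum_le_Q y_spread x_spread)
    show "\<bar>n s1\<bar> \<le> Q" "\<bar>n s2\<bar> \<le> Q" "\<bar>m s1\<bar> \<le> Q" "\<bar>m s2\<bar> \<le> Q"
      using I m n_bounded[of s1] n_bounded[of s2] bounds_le_Q(1) z by simp_all
    show "\<bar>\<sigma> (y s - y s1)\<bar> \<le> Q" "\<bar>\<sigma> (x s - x s1)\<bar> \<le> Q"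
      using \<sigma>_bounded[of "y s - y s1"] \<sigma>_bounded[of "x s - x s1"] bounds_le_Q(3) by linarith+
  qed (use I z in auto)
  also have "\<dots> \<le> Q ^ 3 * ((1 + 2 * C + S + 2 * Q) * (err s + err s1 + err s2 + ?\<chi>))"
    using nm ab \<sigma> bounds_le_Q by (intro mult_left_mono) (auto simp: algebra_simps)
  finally show ?thesis by (simp add: z mult.assoc)
qed

lemma indicator_cell_integral:
  assumes "s \<in> \<I>"
  shows "integrable \<lambda>\<^sub>I (indicator (cell N (idx N s)) :: real \<Rightarrow> real)"
    and "(LINT s1|\<lambda>\<^sub>I. indicator (cell N (idx N s)) s1) = 1 / real N"
  using idx_in_range[OF N assms] cell_subset[OF idx_in_range[OF N assms]] measure_cell cell_sets_unit
  by (auto intro!: integrable_real_indicator simp: unit_ivl.emeasure_eq_measure Int_absorb1 Int_absorb2)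

text \<open>The indicator integrates to the measure of a cell, the source of the term
  \<open>1 / N\<close>. The two integration variables contribute the same integral of
  \<open>err\<close>, hence the factor 2.\<close>

lemma integral_weight_diff_le:
  assumes s: "s \<in> \<I>"
  shows "\<bar>(LINT z|(\<lambda>\<^sub>I \<Otimes>\<^sub>M \<lambda>\<^sub>I). weight y n s z) - (LINT z|(\<lambda>\<^sub>I \<Otimes>\<^sub>M \<lambda>\<^sub>I). weight x m s z)\<bar>
    \<le> Q ^ 3 * (1 + 2 * C + S + 2 * Q) * (err s + 2 * (LINT s|\<lambda>\<^sub>I. err s) + 1 / N)"
proof -
  let ?R = "Q ^ 3 * (1 + 2 * C + S + 2 * Q)"
  have y: "integrable (\<lambda>\<^sub>I \<Otimes>\<^sub>M \<lambda>\<^sub>I) (weight y n s)"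
    using n_bounded by (intro integrable_weight(1)[where B = K, OF _ _ _ y_spread s]) auto
  have x: "integrable (\<lambda>\<^sub>I \<Otimes>\<^sub>M \<lambda>\<^sub>I) (weight x m s)"
    by (intro integrable_weight(1)[OF _ _ m_bounded x_spread s]) auto
  have "\<bar>(LINT z|(\<lambda>\<^sub>I \<Otimes>\<^sub>M \<lambda>\<^sub>I). weight y n s z) - (LINT z|(\<lambda>\<^sub>I \<Otimes>\<^sub>M \<lambda>\<^sub>I). weight x m s z)\<bar>
      = \<bar>LINT z|(\<lambda>\<^sub>I \<Otimes>\<^sub>M \<lambda>\<^sub>I). weight y n s z - weight x m s z\<bar>"
    using x y by simp
  also have "\<dots> \<le> (LINT z|(\<lambda>\<^sub>I \<Otimes>\<^sub>M \<lambda>\<^sub>I). \<bar>weight y n s z - weight x m s z\<bar>)"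
    by (rule integral_abs_bound)
  also have "\<dots> \<le> (LINT z|(\<lambda>\<^sub>I \<Otimes>\<^sub>M \<lambda>\<^sub>I). ?R *
      (err s + err (fst z) + err (snd z) + indicator (cell N (idx N s)) (fst z)))"
  proof (rule integral_mono_AE)
    show "AE z in \<lambda>\<^sub>I \<Otimes>\<^sub>M \<lambda>\<^sub>I. \<bar>weight y n s z - weight x m s z\<bar> \<le> ?R *
      (err s + err (fst z) + err (snd z) + indicator (cell N (idx N s)) (fst z))"
      using AE_pair_unit[OF m_bounded] AE_space
      by eventually_elim (auto intro!: weight_diff_le s simp: space_pair_measure)
  qed (use x y integrable_pair_unit[OF integrable_err] integrable_pair_unit[OF indicator_cell_integral(1)[OF s]] in auto)
  also have "\<dots> = ?R * (err s + 2 * (LINT s|\<lambda>\<^sub>I. err s) + 1 / N)"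
    using integrable_pair_unit[OF integrable_err] integrable_pair_unit[OF indicator_cell_integral(1)[OF s]]
      integral_pair_unit[OF integrable_err] integral_pair_unit[OF indicator_cell_integral(1)[OF s]]
      indicator_cell_integral(2)[OF s] unit_sq.P.prob_space
    by (simp del: integral_indicator Bochner_Integration.integral_indicator)
  finally show ?thesis .
qed

lemma integral_err_nonneg: "0 \<le> (LINT s|\<lambda>\<^sub>I. err s)"
  by (intro Bochner_Integration.integral_nonneg err_nonneg)

lemma total_err_nonneg: "0 \<le> err s + (LINT s|\<lambda>\<^sub>I. err s) + 1 / real N"
  by (intro add_nonneg_nonneg integral_err_nonneg err_nonneg) simp

lemma Lambda_ge: "Q ^ 4 + 2 * Q * (Q ^ 3 * (1 + 2 * C + S + 2 * Q)) \<le> \<Lambda>" "Q * C + Q + C * D \<le> \<Lambda>" "0 \<le> \<Lambda>"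
  using bounds_le_Q C_nonneg S_nonneg D_nonneg by (auto simp: \<Lambda>_def)

lemma Psi_diff_le:
  assumes s: "s \<in> \<I>" and m: "\<bar>m s\<bar> \<le> K"
  shows "\<bar>Psi a \<sigma> s y n - Psi a \<sigma> s x m\<bar> \<le> \<Lambda> * (err s + (LINT s|\<lambda>\<^sub>I. err s) + 1 / N)"
proof -
  let ?R = "Q ^ 3 * (1 + 2 * C + S + 2 * Q)"
  let ?J = "\<lambda>x m. LINT z|(\<lambda>\<^sub>I \<Otimes>\<^sub>M \<lambda>\<^sub>I). weight x m s z"
  let ?e = "err s + (LINT s|\<lambda>\<^sub>I. err s) + 1 / N"
  have "\<bar>?J y n\<bar> \<le> K * K * (2 * (C * D)) * S_inf"
    using n_bounded by (intro integrable_weight(2)[where B = K, OF _ _ _ y_spread s]) auto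
  also have "\<dots> \<le> Q * Q * Q * Q"
    using bounds_le_Q K_nonneg C_nonneg D_nonneg S_inf_nonneg by (intro mult_mono) auto
  finally have J: "\<bar>?J y n\<bar> \<le> Q ^ 4" by (simp add: power4_eq_xxxx)
  have R: "0 \<le> ?R" using bounds_le_Q C_nonneg S_nonneg by auto
  \<comment> \<open>The difference of the outer factors is paired with a bounded integral, and the
    bounded factor \<open>m s\<close> with the difference of the integrals.\<close>
  have "\<bar>Psi a \<sigma> s y n - Psi a \<sigma> s x m\<bar> = \<bar>(n s - m s) * ?J y n + m s * (?J y n - ?J x m)\<bar>"
    by (simp add: Psi_eq_weight algebra_simps)
  also have "\<dots> \<le> \<bar>n s - m s\<bar> * \<bar>?J y n\<bar> + \<bar>m s\<bar> * \<bar>?J y n - ?J x m\<bar>"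
    by (rule abs_sum_prod_le)
  also have "\<dots> \<le> ?e * Q ^ 4 + Q * (?R * (err s + 2 * (LINT s|\<lambda>\<^sub>I. err s) + 1 / N))"
    using J m integral_weight_diff_le[OF s] bounds_le_Q err_nonneg[of s] R integral_err_nonneg
      total_err_nonneg[of s] order_trans[OF err_ge(2)[of s]]
    by (intro add_mono mult_mono) auto
  also have "\<dots> \<le> ?e * Q ^ 4 + Q * (?R * (2 * ?e))"
  proof -
    have "0 \<le> 1 / real N" by simp
    then have "err s + 2 * (LINT s|\<lambda>\<^sub>I. err s) + 1 / N \<le> 2 * ?e"
      using err_nonneg[of s] by argo
    then show ?thesis
      using R bounds_le_Q by (intro add_left_mono mult_left_mono)
  qed
  also have "\<dots> = (Q ^ 4 + 2 * Q * ?R) * ?e"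
    by (simp add: algebra_simps)
  also have "\<dots> \<le> \<Lambda> * ?e"
    by (intro mult_right_mono Lambda_ge total_err_nonneg)
  finally show ?thesis .
qed

lemma drift_diff_le:
  assumes s: "s \<in> \<I>"
  shows "\<bar>(LINT s'|\<lambda>\<^sub>I. n s' * a (y s' - y s)) - (LINT s'|\<lambda>\<^sub>I. m s' * a (x s' - x s))\<bar>
    \<le> \<Lambda> * (err s + (LINT s|\<lambda>\<^sub>I. err s) + 1 / N)"
proof -
  have CD: "C * D \<le> \<Lambda>" "K * C \<le> \<Lambda>" "0 \<le> C * D"
    using bounds_le_Q C_nonneg Lambda_ge mult_right_mono[of K Q C] mult_nonneg_nonneg[of Q C]
      mult_nonneg_nonneg[of C D] D_nonneg by linarith+
  have y: "integrable \<lambda>\<^sub>I (\<lambda>s'. n s' * a (y s' - y s))"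
    using n_bounded s a_bounded[OF y_spread[OF _ s]] K_nonneg
    by (intro unit_ivl.integrable_const_bound[where B = "K * (C * D)"])
       (auto simp: abs_mult intro!: mult_mono)
  have x: "integrable \<lambda>\<^sub>I (\<lambda>s'. m s' * a (x s' - x s))"
  proof (rule unit_ivl.integrable_const_bound[where B = "K * (C * D)"])
    show "AE s' in \<lambda>\<^sub>I. norm (m s' * a (x s' - x s)) \<le> K * (C * D)"
      using m_bounded AE_space
      by eventually_elim (use a_bounded[OF x_spread[OF _ s]] K_nonneg in \<open>auto simp: abs_mult intro!: mult_mono\<close>)
  qed measurable
  have "\<bar>(LINT s'|\<lambda>\<^sub>I. n s' * a (y s' - y s)) - (LINT s'|\<lambda>\<^sub>I. m s' * a (x s' - x s))\<bar>
      = \<bar>LINT s'|\<lambda>\<^sub>I. n s' * a (y s' - y s) - m s' * a (x s' - x s)\<bar>"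
    using x y by simp
  also have "\<dots> \<le> (LINT s'|\<lambda>\<^sub>I. \<bar>n s' * a (y s' - y s) - m s' * a (x s' - x s)\<bar>)"
    by (rule integral_abs_bound)
  also have "\<dots> \<le> (LINT s'|\<lambda>\<^sub>I. \<Lambda> * (err s + err s'))"
  proof (rule integral_mono_AE)
    show "AE s' in \<lambda>\<^sub>I. \<bar>n s' * a (y s' - y s) - m s' * a (x s' - x s)\<bar> \<le> \<Lambda> * (err s + err s')"
      using m_bounded AE_space
    proof eventually_elim
      case (elim s')
      then have s': "s' \<in> \<I>" by simp
      have "\<bar>n s' * a (y s' - y s) - m s' * a (x s' - x s)\<bar>
        = \<bar>(n s' - m s') * a (y s' - y s) + m s' * (a (y s' - y s) - a (x s' - x s))\<bar>"
        by (simp add: algebra_simps)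
      also have "\<dots> \<le> \<bar>n s' - m s'\<bar> * \<bar>a (y s' - y s)\<bar> + \<bar>m s'\<bar> * \<bar>a (y s' - y s) - a (x s' - x s)\<bar>"
        by (rule abs_sum_prod_le)
      also have "\<dots> \<le> \<bar>n s' - m s'\<bar> * (C * D) + K * (C * (\<bar>y s - x s\<bar> + \<bar>y s' - x s'\<bar>))"
      proof (intro add_mono mult_mono elim)
        show "\<bar>a (y s' - y s)\<bar> \<le> C * D" by (rule a_bounded[OF y_spread[OF s' s]])
        show "\<bar>a (y s' - y s) - a (x s' - x s)\<bar> \<le> C * (\<bar>y s - x s\<bar> + \<bar>y s' - x s'\<bar>)"
          using C_nonneg by (intro order_trans[OF a_lipschitz] mult_left_mono) auto
      qed (use K_nonneg in auto)
      also have "\<dots> \<le> \<bar>n s' - m s'\<bar> * \<Lambda> + \<Lambda> * (\<bar>y s - x s\<bar> + \<bar>y s' - x s'\<bar>)"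
        using CD by (intro add_mono mult_left_mono) (auto simp: mult.assoc[symmetric] intro!: mult_right_mono)
      also have "\<dots> \<le> \<Lambda> * (err s + err s')"
        using Lambda_ge(3) by (simp add: err_def algebra_simps)
      finally show ?case .
    qed
  qed (use x y integrable_err in auto)
  also have "\<dots> = \<Lambda> * (err s + (LINT s'|\<lambda>\<^sub>I. err s'))"
    using integrable_err unit_ivl.prob_space by simp
  \<comment> \<open>No \<open>\<sigma>\<close> occurs in the drift, so there is no cell defect;
    \<open>1 / N\<close> is added to match the form of \<open>Psi_diff_le\<close>.\<close>
  also have "\<dots> \<le> \<Lambda> * (err s + (LINT s|\<lambda>\<^sub>I. err s) + 1 / N)"
    using Lambda_ge(3) by (intro mult_left_mono) auto
  finally show ?thesis .
qed

definition "energy = (LINT s|\<lambda>\<^sub>I. (y s - x s)\<^sup>2 + (n s - m s)\<^sup>2)"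

text \<open>The left side is the time derivative of the energy along the two solutions. The factor
  10 arises as 2 times 5: four squares of \<open>err\<close> from the products, a fifth from
  Jensen's inequality for the mean of \<open>err\<close>, and the 2 from comparing
  \<open>err\<close> squared with the energy density.\<close>

lemma energy_rate_le:
  "2 * (LINT s|\<lambda>\<^sub>I. (y s - x s) * ((LINT s'|\<lambda>\<^sub>I. n s' * a (y s' - y s)) - (LINT s'|\<lambda>\<^sub>I. m s' * a (x s' - x s)))
    + (n s - m s) * (Psi a \<sigma> s y n - Psi a \<sigma> s x m)) \<le> 10 * \<Lambda> * energy + \<Lambda> / (real N)\<^sup>2"
proof -
  let ?e = "LINT s|\<lambda>\<^sub>I. err s" and ?N = "1 / real N"
  let ?F = "\<lambda>s. (LINT s'|\<lambda>\<^sub>I. n s' * a (y s' - y s)) - (LINT s'|\<lambda>\<^sub>I. m s' * a (x s' - x s))"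
  let ?P = "\<lambda>s. Psi a \<sigma> s y n - Psi a \<sigma> s x m"
  have sq: "integrable \<lambda>\<^sub>I (\<lambda>s. (y s - x s)\<^sup>2 + (n s - m s)\<^sup>2)"
    by (rule Bochner_Integration.integrable_bound[OF integrable_err_square])
       (auto simp: err_def power2_sum)
  have "(LINT s|\<lambda>\<^sub>I. 2 * ((y s - x s) * ?F s + (n s - m s) * ?P s))
    \<le> (LINT s|\<lambda>\<^sub>I. \<Lambda> * (4 * (err s)\<^sup>2 + ?e\<^sup>2 + ?N\<^sup>2))"
  \<comment> \<open>This form of monotonicity asks for integrability of the upper function only: a
    non-integrable lower function has integral 0, and the upper one is nonnegative.\<close>
  proof (rule integral_mono_AE')
    show "AE s in \<lambda>\<^sub>I. 2 * ((y s - x s) * ?F s + (n s - m s) * ?P s) \<le> \<Lambda> * (4 * (err s)\<^sup>2 + ?e\<^sup>2 + ?N\<^sup>2)"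
      using m_bounded AE_space
    proof eventually_elim
      case (elim s)
      then have s: "s \<in> \<I>" by simp
      let ?r = "\<Lambda> * (err s + ?e + ?N)"
      have "(y s - x s) * ?F s + (n s - m s) * ?P s \<le> \<bar>y s - x s\<bar> * \<bar>?F s\<bar> + \<bar>n s - m s\<bar> * \<bar>?P s\<bar>"
        by (rule order_trans[OF abs_ge_self abs_sum_prod_le])
      also have "\<dots> \<le> \<bar>y s - x s\<bar> * ?r + \<bar>n s - m s\<bar> * ?r"
        using drift_diff_le[OF s] Psi_diff_le[OF s elim(1)] by (intro add_mono mult_left_mono) auto
      also have "\<dots> = \<Lambda> * (err s * (err s + ?e + ?N))"
        by (simp add: err_def algebra_simps)
      finally have "2 * ((y s - x s) * ?F s + (n s - m s) * ?P s) \<le> \<Lambda> * (2 * (err s * (err s + ?e + ?N)))"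
        by argo
      \<comment> \<open>Both mixed products are split by
        \<open>2 * p * q \<le> p\<^sup>2 + q\<^sup>2\<close>.\<close>
      also have "\<dots> \<le> \<Lambda> * (4 * (err s)\<^sup>2 + ?e\<^sup>2 + ?N\<^sup>2)"
        using Lambda_ge(3) sum_squares_bound[of "err s" ?e] sum_squares_bound[of "err s" ?N]
        by (intro mult_left_mono) (simp_all add: power2_eq_square algebra_simps)
      finally show ?case .
    qed
    show "AE s in \<lambda>\<^sub>I. 0 \<le> \<Lambda> * (4 * (err s)\<^sup>2 + ?e\<^sup>2 + ?N\<^sup>2)"
      using Lambda_ge(3) by auto
  qed (use integrable_err_square in auto)
  also have "\<dots> = \<Lambda> * (4 * (LINT s|\<lambda>\<^sub>I. (err s)\<^sup>2) + ?e\<^sup>2 + ?N\<^sup>2)"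
    using integrable_err_square unit_ivl.prob_space by simp
  also have "\<dots> \<le> \<Lambda> * (5 * (LINT s|\<lambda>\<^sub>I. (err s)\<^sup>2) + ?N\<^sup>2)"
    using Lambda_ge(3) integral_square_le[OF integrable_err integrable_err_square]
    by (intro mult_left_mono) auto
  also have "\<dots> \<le> \<Lambda> * (5 * (2 * energy) + ?N\<^sup>2)"
  proof -
    have "(err s)\<^sup>2 \<le> 2 * ((y s - x s)\<^sup>2 + (n s - m s)\<^sup>2)" for s
      using sum_squares_bound[of "\<bar>y s - x s\<bar>" "\<bar>n s - m s\<bar>"]
      by (simp add: err_def power2_sum)
    then have "(LINT s|\<lambda>\<^sub>I. (err s)\<^sup>2) \<le> (LINT s|\<lambda>\<^sub>I. 2 * ((y s - x s)\<^sup>2 + (n s - m s)\<^sup>2))"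
      by (intro integral_mono integrable_err_square integrable_mult_right sq)
    also have "\<dots> = 2 * energy"
      unfolding energy_def by (rule integral_mult_right_zero)
    finally show ?thesis
      using Lambda_ge(3) by (intro mult_left_mono) auto
  qed
  also have "\<dots> = 10 * \<Lambda> * energy + \<Lambda> / (real N)\<^sup>2"
    by (simp add: power_divide algebra_simps)
  finally show ?thesis
    unfolding integral_mult_right_zero .
qed

end

section \<open>Convergence\<close>

text \<open>Only finitely many components occur, so their separate rates of convergence can be made
  uniform.\<close>

lemma Linf_deriv_idx:
  assumes N: "1 \<le> N" and f: "\<And>i. i \<in> {1..N} \<Longrightarrow> ((\<lambda>\<tau>. f \<tau> i) has_real_derivative g i) (at t within {0..T})"
  shows "Linf_deriv T (\<lambda>\<tau> s. f \<tau> (idx N s)) (\<lambda>s. g (idx N s)) t"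
  unfolding Linf_deriv_def
proof (intro allI impI)
  fix \<epsilon> :: real assume "0 < \<epsilon>"
  then have "\<forall>\<^sub>F \<tau> in at t within {0..T}. \<forall>i\<in>{1..N}. \<bar>f \<tau> i - f t i - (\<tau> - t) * g i\<bar> \<le> \<epsilon> * \<bar>\<tau> - t\<bar>"
    using f unfolding has_real_derivative_within_iff by (intro eventually_ball_finite) auto
  then show "\<forall>\<^sub>F \<tau> in at t within {0..T}. AE s in \<lambda>\<^sub>I.
      \<bar>f \<tau> (idx N s) - f t (idx N s) - (\<tau> - t) * g (idx N s)\<bar> \<le> \<epsilon> * \<bar>\<tau> - t\<bar>"
  proof eventually_elim
    case (elim \<tau>)
    show ?case
      by (rule AE_I2) (use elim idx_in_range[OF N] in simp)
  qed
qed

section \<open>The vector field of the finite system\<close>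

context opinion_kernel
begin

definition drift :: "nat \<Rightarrow> (nat \<Rightarrow> real) \<Rightarrow> (nat \<Rightarrow> real) \<Rightarrow> nat \<Rightarrow> real"
  where "drift N v w i = (\<Sum>j=1..N. w j * a (v j - v i)) / real N"

lemma drift_idx:
  assumes "1 \<le> N"
  shows "(LINT s'|\<lambda>\<^sub>I. w (idx N s') * a (v (idx N s') - v i)) = drift N v w i"
  unfolding drift_def by (rule integral_idx[OF assms])

text \<open>Both agents face the same weighted crowd, so the drifts differ only through their own
  positions. The constant becomes \<open>C\<close> once the mean absolute weight is known to be
  1.\<close>

lemma abs_drift_diff_le:
  "\<bar>drift N v w i - drift N v w j\<bar> \<le> (\<Sum>k=1..N. \<bar>w k\<bar>) / real N * C * \<bar>v i - v j\<bar>"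
proof -
  have "\<bar>\<Sum>k=1..N. w k * (a (v k - v i) - a (v k - v j))\<bar> \<le> (\<Sum>k=1..N. \<bar>w k\<bar> * (C * \<bar>v i - v j\<bar>))"
  proof (rule sum_abs[THEN order_trans], rule sum_mono)
    fix k
    have "\<bar>a (v k - v i) - a (v k - v j)\<bar> \<le> C * \<bar>v i - v j\<bar>"
      using a_lipschitz[of "v k - v i" "v k - v j"] by (simp add: abs_minus_commute)
    then show "\<bar>w k * (a (v k - v i) - a (v k - v j))\<bar> \<le> \<bar>w k\<bar> * (C * \<bar>v i - v j\<bar>)"
      unfolding abs_mult by (rule mult_left_mono) simp
  qed
  also have "\<dots> = (\<Sum>k=1..N. \<bar>w k\<bar>) * C * \<bar>v i - v j\<bar>"
    by (simp add: sum_distrib_right mult.assoc)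
  finally have "\<bar>\<Sum>k=1..N. w k * (a (v k - v i) - a (v k - v j))\<bar> / real N \<le> (\<Sum>k=1..N. \<bar>w k\<bar>) * C * \<bar>v i - v j\<bar> / real N"
    by (rule divide_right_mono) simp
  then show ?thesis
    by (simp add: drift_def sum_subtractf right_diff_distrib flip: diff_divide_distrib)
qed

lemma abs_growth_le:
  assumes D: "\<And>k l. k \<in> {1..N} \<Longrightarrow> l \<in> {1..N} \<Longrightarrow> \<bar>v k - v l\<bar> \<le> D" and i: "i \<in> {1..N}"
  shows "\<bar>growth N v w i\<bar> \<le> 2 * C * D * S_inf * ((\<Sum>k=1..N. \<bar>w k\<bar>) / real N)\<^sup>2"
proof -
  let ?c = "2 * (C * D) * S_inf"
  have "\<bar>\<Sum>k=1..N. w j * w k * (a (v k - v i) + a (v k - v j)) * \<sigma> (v i - v j)\<bar> / real N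
      \<le> (\<Sum>k=1..N. \<bar>w j\<bar> * \<bar>w k\<bar> * ?c) / real N" if j: "j \<in> {1..N}" for j
  proof (intro divide_right_mono sum_abs[THEN order_trans] sum_mono)
    fix k assume k: "k \<in> {1..N}"
    have "\<bar>a (v k - v i) + a (v k - v j)\<bar> \<le> 2 * (C * D)"
      using a_bounded[OF D[OF k i]] a_bounded[OF D[OF k j]] by linarith
    then have "\<bar>w j * w k\<bar> * (\<bar>a (v k - v i) + a (v k - v j)\<bar> * \<bar>\<sigma> (v i - v j)\<bar>) \<le> \<bar>w j * w k\<bar> * ?c"
      using \<sigma>_bounded by (intro mult_left_mono mult_mono) auto
    then show "\<bar>w j * w k * (a (v k - v i) + a (v k - v j)) * \<sigma> (v i - v j)\<bar> \<le> \<bar>w j\<bar> * \<bar>w k\<bar> * ?c"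
      by (simp add: abs_mult mult.assoc)
  qed simp
  then have "\<bar>growth N v w i\<bar> \<le> (\<Sum>j=1..N. (\<Sum>k=1..N. \<bar>w j\<bar> * \<bar>w k\<bar> * ?c) / real N) / real N"
    unfolding growth_def abs_divide abs_of_nat
    by (intro divide_right_mono sum_abs[THEN order_trans] sum_mono) (auto simp: abs_divide)
  also have "\<dots> = (\<Sum>j=1..N. \<Sum>k=1..N. \<bar>w j\<bar> * \<bar>w k\<bar>) * ?c / (real N)\<^sup>2"
    by (simp add: sum_distrib_right sum_divide_distrib power2_eq_square)
  also have "\<dots> = 2 * C * D * S_inf * ((\<Sum>k=1..N. \<bar>w k\<bar>) / real N)\<^sup>2"
    by (simp add: power2_eq_square sum_product[symmetric])
  finally show ?thesis .
qed

text \<open>The total mass is conserved because its rate is antisymmetric in the two summation indices.\<close>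

lemma sum_growth_eq_0: "(\<Sum>i=1..N. w i * growth N v w i) = 0"
proof -
  \<comment> \<open>The product of weights and the sum of the two \<open>a\<close> terms are
    symmetric in \<open>i\<close> and \<open>j\<close>; the change of sign comes from
    \<open>\<sigma>\<close> alone.\<close>
  define g where "g i j = w i * ((\<Sum>k=1..N. w j * w k * (a (v k - v i) + a (v k - v j)) * \<sigma> (v i - v j)) / real N)" for i j
  have g: "g i j = - g j i" for i j
    using \<sigma>_odd[of "v j - v i"]
    by (simp add: g_def sum_distrib_left sum_negf add.commute mult_ac)
  have "(\<Sum>i=1..N. \<Sum>j=1..N. g i j) = (\<Sum>i=1..N. \<Sum>j=1..N. - g j i)"
    by (intro sum.cong refl g)
  also have "\<dots> = - (\<Sum>j=1..N. \<Sum>i=1..N. g j i)"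
    by (subst sum.swap) (simp add: sum_negf)
  finally have "(\<Sum>i=1..N. \<Sum>j=1..N. g i j) = 0" by simp
  moreover have "w i * growth N v w i = (\<Sum>j=1..N. g i j) / real N" for i
    by (simp add: growth_def g_def sum_distrib_left)
  ultimately show ?thesis by (simp flip: sum_divide_distrib)
qed

end

locale mean_field_limit = opinion_kernel +
  fixes x0 m0 :: "real \<Rightarrow> real" and X M T :: real
    and x m :: "real \<Rightarrow> real \<Rightarrow> real" and xs ms :: "nat \<Rightarrow> real \<Rightarrow> nat \<Rightarrow> real"
  assumes T_pos: "0 < T"
    and m0_measurable: "m0 \<in> borel_measurable \<lambda>\<^sub>I"
    and m0_mass: "(LINT s|\<lambda>\<^sub>I. m0 s) = 1"
    and M_pos: "0 < M"
    and m0_between: "AE s in \<lambda>\<^sub>I. 1 / M \<le> m0 s \<and> m0 s \<le> M"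
    and x0_continuous: "continuous_on \<I> x0"
    and x0_inj: "inj_on x0 \<I>"
    and x0_bounded: "s \<in> \<I> \<Longrightarrow> \<bar>x0 s\<bar> \<le> X"
    and limit: "graph_limit_solution a \<sigma> x0 m0 T x m"
    and system: "1 \<le> N \<Longrightarrow> opinion_system_solution a \<sigma> x0 m0 T N (xs N) (ms N)"
begin

text \<open>Initial opinions lie within \<open>X\<close> of 0 and, at mean absolute weight 1, their
  differences grow at rate at most \<open>C\<close>. The exponent of \<open>mass_bound\<close> comes
  from the resulting bound on \<open>growth\<close>. Neither constant involves
  \<open>N\<close>.\<close>

definition "spread = 2 * X * exp (C * T)"
definition "mass_bound = M * exp (2 * C * spread * S_inf * T)"

lemma m0_bounded: "AE s in \<lambda>\<^sub>I. \<bar>m0 s\<bar> \<le> M"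
  using m0_between
proof eventually_elim
  case (elim s)
  moreover have "0 < 1 / M" using M_pos by simp
  ultimately show ?case by linarith
qed

section \<open>A priori bounds for the finite systems\<close>

context
  fixes N :: nat assumes N: "1 \<le> N"
begin

lemma xs_deriv:
  "i \<in> {1..N} \<Longrightarrow> t \<in> {0..T} \<Longrightarrow> ((\<lambda>\<tau>. xs N \<tau> i) has_real_derivative drift N (xs N t) (ms N t) i) (at t within {0..T})"
  using system[OF N] by (auto simp: opinion_system_solution_def Let_def drift_def)

lemma ms_deriv:
  "i \<in> {1..N} \<Longrightarrow> t \<in> {0..T} \<Longrightarrow> ((\<lambda>\<tau>. ms N \<tau> i) has_real_derivative ms N t i * growth N (xs N t) (ms N t) i) (at t within {0..T})"
  using system[OF N] by (auto simp: opinion_system_solution_def Let_def simp flip: psi_N_eq)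

lemma initial_values: "i \<in> {1..N} \<Longrightarrow> xs N 0 i = cell_avg N i x0" "i \<in> {1..N} \<Longrightarrow> ms N 0 i = cell_avg N i m0"
  using system[OF N] by (auto simp: opinion_system_solution_def Let_def)

lemma xs_continuous: "i \<in> {1..N} \<Longrightarrow> continuous_on {0..T} (\<lambda>\<tau>. xs N \<tau> i)"
  by (rule DERIV_continuous_on[OF xs_deriv])

lemma ms_continuous: "i \<in> {1..N} \<Longrightarrow> continuous_on {0..T} (\<lambda>\<tau>. ms N \<tau> i)"
  by (rule DERIV_continuous_on[OF ms_deriv])

lemma ms_pos:
  assumes i: "i \<in> {1..N}" and t: "t \<in> {0..T}"
  shows "0 < ms N t i"
proof -
  \<comment> \<open>The bound of \<open>abs_growth_le\<close> with the spread estimated by twice the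
    sum of all absolute opinions. It is continuous in time, hence bounded, by a constant that may
    depend on \<open>N\<close>.\<close>
  define g where "g t = 2 * C * (2 * (\<Sum>k=1..N. \<bar>xs N t k\<bar>)) * S_inf * ((\<Sum>k=1..N. \<bar>ms N t k\<bar>) / real N)\<^sup>2" for t
  have "continuous_on {0..T} g"
    unfolding g_def using N by (intro continuous_intros xs_continuous ms_continuous) auto
  then have "bounded (g ` {0..T})"
    by (intro compact_imp_bounded compact_continuous_image) auto
  then obtain K where "\<forall>t\<in>{0..T}. \<bar>g t\<bar> \<le> K"
    unfolding bounded_iff by auto
  then have K: "g t \<le> K" if "t \<in> {0..T}" for t
    using that abs_le_D1 by blast
  have growth: "\<bar>growth N (xs N t) (ms N t) i\<bar> \<le> K" if "t \<in> {0..T}" for t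
  proof (rule order_trans[OF abs_growth_le[OF _ i] K[OF that, unfolded g_def]])
    fix k l assume "k \<in> {1..N}" "l \<in> {1..N}"
    then have "\<bar>xs N t k\<bar> \<le> (\<Sum>k=1..N. \<bar>xs N t k\<bar>)" "\<bar>xs N t l\<bar> \<le> (\<Sum>k=1..N. \<bar>xs N t k\<bar>)"
      by (auto intro!: member_le_sum[of _ _ "\<lambda>k. \<bar>xs N t k\<bar>"])
    then show "\<bar>xs N t k - xs N t l\<bar> \<le> 2 * (\<Sum>k=1..N. \<bar>xs N t k\<bar>)" by linarith
  qed
  have "sgn (ms N t i) = sgn (ms N 0 i)"
  proof (rule linear_ode_sgn[OF ms_deriv[OF i] _ t])
    fix \<tau> assume "\<tau> \<in> {0..T}"
    from mult_right_mono[OF growth[OF this] abs_ge_zero[of "ms N \<tau> i"]]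
    show "\<bar>ms N \<tau> i * growth N (xs N \<tau>) (ms N \<tau>) i\<bar> \<le> K * \<bar>ms N \<tau> i\<bar>"
      by (simp add: abs_mult mult.commute)
  qed
  moreover have "0 < ms N 0 i"
    using cell_avg_between(1)[OF i m0_measurable m0_between] M_pos initial_values(2)[OF i]
    by (simp add: less_le_trans[of 0 "1 / M"])
  ultimately show ?thesis by (simp add: sgn_1_pos)
qed

text \<open>Absolute values appear because the drift and growth bounds contain them; positivity of
  the weights removes them, and the signed sum is conserved.\<close>

lemma ms_mass:
  assumes t: "t \<in> {0..T}"
  shows "(\<Sum>i=1..N. \<bar>ms N t i\<bar>) / real N = 1"
proof -
  have abs: "(\<Sum>i=1..N. \<bar>ms N \<tau> i\<bar>) = (\<Sum>i=1..N. ms N \<tau> i)" if "\<tau> \<in> {0..T}" for \<tau>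
    using ms_pos[OF _ that] by (intro sum.cong) (auto simp: less_imp_le)
  have "integrable \<lambda>\<^sub>I m0"
    by (rule integrable_bounded_unit[OF m0_measurable m0_bounded])
  from integral_mult_idx[OF N this, of "\<lambda>_. 1"]
  have "(\<Sum>i=1..N. cell_avg N i m0) = real N"
    using m0_mass N by (simp add: field_simps)
  then have 0: "(\<Sum>i=1..N. ms N 0 i) = real N"
    using initial_values(2) by simp
  let ?u = "\<lambda>t. (\<Sum>i=1..N. ms N t i) - real N"
  \<comment> \<open>The mass defect has derivative 0, so the growth estimate applies with rate 0,
    and the defect vanishes initially.\<close>
  have "\<bar>?u t\<bar> \<le> \<bar>?u 0\<bar> * exp (0 * t)"
  proof (rule linear_ode_growth[OF _ _ t])
    fix \<tau> assume \<tau>: "\<tau> \<in> {0..T}"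
    show "(?u has_real_derivative (\<Sum>i=1..N. ms N \<tau> i * growth N (xs N \<tau>) (ms N \<tau>) i) - 0) (at \<tau> within {0..T})"
      using \<tau> by (intro DERIV_diff DERIV_sum ms_deriv DERIV_const) auto
  qed (simp add: sum_growth_eq_0[simplified])
  then have "(\<Sum>i=1..N. ms N t i) = real N" using 0 by simp
  with N abs[OF t] show ?thesis by simp
qed

lemma
  assumes ij: "i \<in> {1..N}" "j \<in> {1..N}" and t: "t \<in> {0..T}"
  shows xs_diff_le: "\<bar>xs N t i - xs N t j\<bar> \<le> \<bar>xs N 0 i - xs N 0 j\<bar> * exp (C * t)"
    and xs_diff_sgn: "sgn (xs N t i - xs N t j) = sgn (xs N 0 i - xs N 0 j)"
proof -
  have deriv: "((\<lambda>\<tau>. xs N \<tau> i - xs N \<tau> j) has_real_derivative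
      drift N (xs N \<tau>) (ms N \<tau>) i - drift N (xs N \<tau>) (ms N \<tau>) j) (at \<tau> within {0..T})" if "\<tau> \<in> {0..T}" for \<tau>
    using that ij by (intro DERIV_diff xs_deriv)
  have le: "\<bar>drift N (xs N \<tau>) (ms N \<tau>) i - drift N (xs N \<tau>) (ms N \<tau>) j\<bar> \<le> C * \<bar>xs N \<tau> i - xs N \<tau> j\<bar>" if "\<tau> \<in> {0..T}" for \<tau>
    using abs_drift_diff_le[of N "xs N \<tau>" "ms N \<tau>" i j] ms_mass[OF that] by simp
  show "\<bar>xs N t i - xs N t j\<bar> \<le> \<bar>xs N 0 i - xs N 0 j\<bar> * exp (C * t)"
    by (rule linear_ode_growth[OF deriv le t])
  show "sgn (xs N t i - xs N t j) = sgn (xs N 0 i - xs N 0 j)"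
    by (rule linear_ode_sgn[OF deriv le t])
qed

lemma initial_mean_value:
  assumes "i \<in> {1..N}"
  obtains \<xi> where "(real i - 1) / real N < \<xi>" "\<xi> < real i / real N" "\<xi> \<in> \<I>" "xs N 0 i = x0 \<xi>"
proof -
  from cell_avg_mean_value[OF assms x0_continuous] obtain \<xi> where \<xi>:
    "(real i - 1) / real N < \<xi>" "\<xi> < real i / real N" "cell_avg N i x0 = x0 \<xi>" by blast
  moreover have "\<xi> \<in> \<I>"
    using cell_subset[OF assms] \<xi> by (auto simp: cell_def)
  ultimately show thesis
    using initial_values(1)[OF assms] by (intro that) auto
qed

lemma xs_spread:
  assumes ij: "i \<in> {1..N}" "j \<in> {1..N}" and t: "t \<in> {0..T}"
  shows "\<bar>xs N t i - xs N t j\<bar> \<le> spread"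
proof -
  obtain \<xi> \<eta> where "\<xi> \<in> \<I>" "xs N 0 i = x0 \<xi>" "\<eta> \<in> \<I>" "xs N 0 j = x0 \<eta>"
    using initial_mean_value[OF ij(1)] initial_mean_value[OF ij(2)] by metis
  then have 0: "\<bar>xs N 0 i - xs N 0 j\<bar> \<le> 2 * X"
    using x0_bounded[of \<xi>] x0_bounded[of \<eta>] by linarith
  then have "\<bar>xs N 0 i - xs N 0 j\<bar> * exp (C * t) \<le> 2 * X * exp (C * T)"
    using t C_nonneg by (intro mult_mono) (auto intro: mult_left_mono)
  with xs_diff_le[OF ij t] show ?thesis by (simp add: spread_def)
qed

lemma ms_bounded:
  assumes i: "i \<in> {1..N}" and t: "t \<in> {0..T}"
  shows "\<bar>ms N t i\<bar> \<le> mass_bound"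
proof -
  let ?K = "2 * C * spread * S_inf"
  have "0 \<le> spread" using xs_spread[OF i i t] by simp
  then have K: "0 \<le> ?K" using C_nonneg S_inf_nonneg by simp
  have "\<bar>ms N t i\<bar> \<le> \<bar>ms N 0 i\<bar> * exp (?K * t)"
  proof (rule linear_ode_growth[OF ms_deriv[OF i] _ t])
    fix \<tau> assume \<tau>: "\<tau> \<in> {0..T}"
    have "\<bar>growth N (xs N \<tau>) (ms N \<tau>) i\<bar> \<le> ?K"
      using abs_growth_le[OF xs_spread[OF _ _ \<tau>] i, where w = "ms N \<tau>"] ms_mass[OF \<tau>] by simp
    from mult_right_mono[OF this abs_ge_zero[of "ms N \<tau> i"]]
    show "\<bar>ms N \<tau> i * growth N (xs N \<tau>) (ms N \<tau>) i\<bar> \<le> ?K * \<bar>ms N \<tau> i\<bar>"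
      by (simp add: abs_mult mult.commute)
  qed
  also have "\<dots> \<le> M * exp (?K * T)"
  proof (intro mult_mono)
    show "\<bar>ms N 0 i\<bar> \<le> M"
      using cell_avg_between(2)[OF i m0_measurable m0_between] ms_pos[OF i, of 0] T_pos initial_values(2)[OF i] by simp
    show "exp (?K * t) \<le> exp (?K * T)"
      using mult_left_mono[OF _ K, of t T] t by simp
  qed (use M_pos in auto)
  finally show ?thesis by (simp add: mass_bound_def)
qed

text \<open>An initial opinion is a value of \<open>x0\<close> inside the open cell. For different
  cells these sample points are ordered as \<open>s\<close> and \<open>s'\<close> are, and strict
  monotonicity of \<open>x0\<close> transfers the order to the values.\<close>

lemma initial_order:
  assumes s: "s \<in> \<I>" "s' \<in> \<I>" "idx N s \<noteq> idx N s'"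
  shows "sgn (xs N 0 (idx N s) - xs N 0 (idx N s')) = sgn (x0 s - x0 s')" "x0 s \<noteq> x0 s'"
proof -
  have less: "sgn (xs N 0 (idx N s) - xs N 0 (idx N s')) = sgn (x0 s - x0 s')" if s: "s \<in> \<I>" "s' \<in> \<I>" "idx N s < idx N s'" for s s'
  proof -
    have "s < s'" using idx_mono[of s' s N] s(3) by force
    obtain \<xi> where \<xi>: "\<xi> < real (idx N s) / real N" "\<xi> \<in> \<I>" "xs N 0 (idx N s) = x0 \<xi>"
      using initial_mean_value[OF idx_in_range[OF N s(1)]] by metis
    obtain \<eta> where \<eta>: "(real (idx N s') - 1) / real N < \<eta>" "\<eta> \<in> \<I>" "xs N 0 (idx N s') = x0 \<eta>"
      using initial_mean_value[OF idx_in_range[OF N s(2)]] by metis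
    have "real (idx N s) / real N \<le> (real (idx N s') - 1) / real N"
      using s(3) by (intro divide_right_mono) auto
    with \<xi> \<eta> have "\<xi> < \<eta>" by linarith
    \<comment> \<open>Injectivity and continuity on an interval leave both directions possible, so
      only signs are compared.\<close>
    have "strict_mono_on \<I> x0 \<or> strict_antimono_on \<I> x0"
      using injective_eq_monotone_map[OF _ x0_continuous] x0_inj by (simp add: is_interval_cc)
    then show ?thesis
    proof
      assume "strict_mono_on \<I> x0"
      then show ?thesis
        using strict_mono_onD[of \<I> x0] \<open>s < s'\<close> \<open>\<xi> < \<eta>\<close> \<xi> \<eta> s by simp
    next
      assume "strict_antimono_on \<I> x0"
      then show ?thesis
        using monotone_onD[of \<I> "(<)" "(>)" x0] \<open>s < s'\<close> \<open>\<xi> < \<eta>\<close> \<xi> \<eta> s by simp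
    qed
  qed
  show "sgn (xs N 0 (idx N s) - xs N 0 (idx N s')) = sgn (x0 s - x0 s')"
  proof (cases "idx N s < idx N s'")
    case False
    then have "idx N s' < idx N s" using s(3) by simp
    from less[OF s(2,1) this] show ?thesis
      by (metis minus_diff_eq sgn_minus)
  qed (use less s in blast)
  show "x0 s \<noteq> x0 s'"
    using x0_inj s by (auto dest: inj_onD)
qed

end

section \<open>The limit solution and the energy estimate\<close>

lemma limit_x_C1: "has_C1_derivative C_space C_norm T x (\<lambda>t s. LINT s'|\<lambda>\<^sub>I. m t s' * a (x t s' - x t s))"
  and limit_m_C1: "has_C1_derivative Linf_space Linf_norm T m (\<lambda>t s. Psi a \<sigma> s (x t) (m t))"
  and limit_x_initial: "s \<in> \<I> \<Longrightarrow> x 0 s = x0 s"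
  and limit_m_initial: "AE s in \<lambda>\<^sub>I. m 0 s = m0 s"
  using limit by (auto simp: graph_limit_solution_def)

lemma limit_spaces:
  assumes "t \<in> {0..T}"
  shows "x t \<in> C_space" "(\<lambda>s. LINT s'|\<lambda>\<^sub>I. m t s' * a (x t s' - x t s)) \<in> C_space"
    "m t \<in> Linf_space" "(\<lambda>s. Psi a \<sigma> s (x t) (m t)) \<in> Linf_space"
  using limit_x_C1 limit_m_C1 assms by (auto simp: has_C1_derivative_def)

lemma limit_measurable:
  assumes "t \<in> {0..T}"
  shows "x t \<in> borel_measurable \<lambda>\<^sub>I" "m t \<in> borel_measurable \<lambda>\<^sub>I"
  using limit_spaces[OF assms] C_space_imp_Linf_space[of "x t"] by (auto simp: Linf_space_def)

definition energy :: "nat \<Rightarrow> real \<Rightarrow> real"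
  where "energy N t = (LINT s|\<lambda>\<^sub>I. (xs N t (idx N s) - x t s)\<^sup>2) + (LINT s|\<lambda>\<^sub>I. (ms N t (idx N s) - m t s)\<^sup>2)"

context
  fixes B :: real
  assumes m_bounded: "t \<in> {0..T} \<Longrightarrow> AE s in \<lambda>\<^sub>I. \<bar>m t s\<bar> \<le> B"
begin

lemma B_nonneg: "0 \<le> B"
proof -
  have "AE s in \<lambda>\<^sub>I. \<bar>m 0 s\<bar> \<le> B" using T_pos by (intro m_bounded) simp
  then have "AE s in \<lambda>\<^sub>I. 0 \<le> B" by eventually_elim linarith
  then show ?thesis by simp
qed

text \<open>The essential bound \<open>B\<close> plays the part that the mean absolute weight plays
  for the finite system, whence the rate \<open>B * C\<close> in place of \<open>C\<close>.\<close>

lemma limit_drift_diff_le: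
  assumes t: "t \<in> {0..T}" and s: "s \<in> \<I>" "s' \<in> \<I>"
  shows "\<bar>(LINT r|\<lambda>\<^sub>I. m t r * a (x t r - x t s)) - (LINT r|\<lambda>\<^sub>I. m t r * a (x t r - x t s'))\<bar> \<le> B * C * \<bar>x t s - x t s'\<bar>"
proof -
  note [measurable] = limit_measurable[OF t]
  obtain D where D: "AE r in \<lambda>\<^sub>I. \<bar>x t r\<bar> \<le> D"
    using Linf_space_imp_bounded[OF C_space_imp_Linf_space[OF limit_spaces(1)[OF t]]] by blast
  have a_Linf: "(\<lambda>r. a (x t r - x t q)) \<in> Linf_space" for q
  proof (rule Linf_spaceI)
    show "AE r in \<lambda>\<^sub>I. \<bar>a (x t r - x t q)\<bar> \<le> C * (D + \<bar>x t q\<bar>)"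
      using D by eventually_elim (intro a_bounded, linarith)
  qed measurable
  have int: "integrable \<lambda>\<^sub>I (\<lambda>r. m t r * a (x t r - x t q))" for q
    by (intro integrable_mult_Linf a_Linf limit_spaces t)
  have "\<bar>(LINT r|\<lambda>\<^sub>I. m t r * a (x t r - x t s)) - (LINT r|\<lambda>\<^sub>I. m t r * a (x t r - x t s'))\<bar>
      = \<bar>LINT r|\<lambda>\<^sub>I. m t r * a (x t r - x t s) - m t r * a (x t r - x t s')\<bar>"
    using int by simp
  also have "\<dots> \<le> (LINT r|\<lambda>\<^sub>I. \<bar>m t r * a (x t r - x t s) - m t r * a (x t r - x t s')\<bar>)"
    by (rule integral_abs_bound)
  also have "\<dots> \<le> (LINT r|\<lambda>\<^sub>I. B * (C * \<bar>x t s - x t s'\<bar>))"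
  proof (rule integral_mono_AE)
    show "AE r in \<lambda>\<^sub>I. \<bar>m t r * a (x t r - x t s) - m t r * a (x t r - x t s')\<bar> \<le> B * (C * \<bar>x t s - x t s'\<bar>)"
      using m_bounded[OF t]
    proof eventually_elim
      case (elim r)
      have "\<bar>a (x t r - x t s) - a (x t r - x t s')\<bar> \<le> C * \<bar>x t s - x t s'\<bar>"
        using a_lipschitz[of "x t r - x t s" "x t r - x t s'"] by (simp add: abs_minus_commute)
      then show ?case
        unfolding right_diff_distrib[symmetric] abs_mult
        by (intro mult_mono elim B_nonneg abs_ge_zero)
    qed
  qed (use int in auto)
  also have "\<dots> = B * C * \<bar>x t s - x t s'\<bar>"
    using unit_ivl.prob_space by simp
  finally show ?thesis .
qed

text \<open>Order is required for every pair of points. The \<open>x\<close>-equation holds in the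
  supremum norm, so each point of \<open>\<I>\<close> follows a scalar differential equation of its
  own, without exceptional null sets.\<close>

lemma
  assumes t: "t \<in> {0..T}" and s: "s \<in> \<I>" "s' \<in> \<I>"
  shows limit_x_spread: "\<bar>x t s - x t s'\<bar> \<le> 2 * X * exp (B * C * T)"
    and limit_x_sgn: "sgn (x t s - x t s') = sgn (x0 s - x0 s')"
proof -
  have deriv: "((\<lambda>\<tau>. x \<tau> s - x \<tau> s') has_real_derivative
      (LINT r|\<lambda>\<^sub>I. m \<tau> r * a (x \<tau> r - x \<tau> s)) - (LINT r|\<lambda>\<^sub>I. m \<tau> r * a (x \<tau> r - x \<tau> s'))) (at \<tau> within {0..T})"
    if "\<tau> \<in> {0..T}" for \<tau>
    using has_C1_derivative_C_imp_has_real_derivative[OF limit_x_C1 that] s by (intro DERIV_diff)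
  have le: "\<bar>(LINT r|\<lambda>\<^sub>I. m \<tau> r * a (x \<tau> r - x \<tau> s)) - (LINT r|\<lambda>\<^sub>I. m \<tau> r * a (x \<tau> r - x \<tau> s'))\<bar>
      \<le> B * C * \<bar>x \<tau> s - x \<tau> s'\<bar>" if "\<tau> \<in> {0..T}" for \<tau>
    by (rule limit_drift_diff_le[OF that s])
  have "\<bar>x t s - x t s'\<bar> \<le> \<bar>x 0 s - x 0 s'\<bar> * exp (B * C * t)"
    by (rule linear_ode_growth[OF deriv le t])
  also have "\<dots> \<le> 2 * X * exp (B * C * T)"
  proof (intro mult_mono)
    show "\<bar>x 0 s - x 0 s'\<bar> \<le> 2 * X"
      using x0_bounded[OF s(1)] x0_bounded[OF s(2)] limit_x_initial s by simp
    have "B * C * t \<le> B * C * T"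
      using t B_nonneg C_nonneg by (intro mult_left_mono) auto
    then show "exp (B * C * t) \<le> exp (B * C * T)" by simp
  qed (use x0_bounded[OF s(1)] in auto)
  finally show "\<bar>x t s - x t s'\<bar> \<le> 2 * X * exp (B * C * T)" .
  show "sgn (x t s - x t s') = sgn (x0 s - x0 s')"
    using linear_ode_sgn[OF deriv le t] limit_x_initial s by simp
qed

definition "K = max B mass_bound"
definition "D = max spread (2 * X * exp (B * C * T))"

lemma comparison:
  assumes N: "1 \<le> N" and t: "t \<in> {0..T}"
  shows "kernel_comparison a \<sigma> C S S_inf N (xs N t) (ms N t) (x t) (m t) K D"
proof unfold_locales
  show "AE s in \<lambda>\<^sub>I. \<bar>m t s\<bar> \<le> K"
    using m_bounded[OF t] by eventually_elim (simp add: K_def)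
  show "\<bar>x t s - x t s'\<bar> \<le> D" if "s \<in> \<I>" "s' \<in> \<I>" for s s'
    using limit_x_spread[OF t that] by (simp add: D_def)
  show "\<bar>ms N t i\<bar> \<le> K" if "i \<in> {1..N}" for i
    using ms_bounded[OF N that t] by (simp add: K_def)
  show "\<bar>xs N t i - xs N t j\<bar> \<le> D" if "i \<in> {1..N}" "j \<in> {1..N}" for i j
    using xs_spread[OF N that t] by (simp add: D_def)
  show "0 < (xs N t (idx N s) - xs N t (idx N s')) * (x t s - x t s')"
    if s: "s \<in> \<I>" "s' \<in> \<I>" "idx N s \<noteq> idx N s'" for s s'
  proof -
    \<comment> \<open>Both factors keep the sign of \<open>x0 s - x0 s'\<close>, which is nonzero,
      so their product has the square of that sign.\<close>
    have "sgn (xs N t (idx N s) - xs N t (idx N s')) = sgn (x0 s - x0 s')"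
      using xs_diff_sgn[OF N idx_in_range[OF N s(1)] idx_in_range[OF N s(2)] t] initial_order(1)[OF N s] by simp
    then have "sgn ((xs N t (idx N s) - xs N t (idx N s')) * (x t s - x t s')) = sgn (x0 s - x0 s') * sgn (x0 s - x0 s')"
      by (simp add: sgn_mult limit_x_sgn[OF t s(1,2)])
    also have "\<dots> = 1"
      using initial_order(2)[OF N s] by (simp add: sgn_if)
    finally show ?thesis by (simp add: sgn_1_pos)
  qed
qed (use N limit_measurable[OF t] in auto)

text \<open>As a constant of the locale, \<open>\<Lambda>\<close> takes only \<open>C\<close>,
  \<open>S\<close>, \<open>S_inf\<close>, \<open>K\<close> and \<open>D\<close> as arguments; this
  makes the Gronwall rate independent of \<open>N\<close> and of time.\<close>

definition "rate = kernel_comparison.\<Lambda> C S S_inf K D"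

lemma rate_nonneg: "0 \<le> rate"
proof -
  \<comment> \<open>Any instance will do, since the constant is the same for all; the one for
    \<open>N = 1\<close> at time 0 is at hand.\<close>
  interpret cmp: kernel_comparison a "\<sigma>" C S S_inf 1 "xs 1 0" "ms 1 0" "x 0" "m 0" K D
    using T_pos by (intro comparison) auto
  show ?thesis unfolding rate_def by (rule cmp.Lambda_ge(3))
qed

lemma energy_le:
  assumes N: "1 \<le> N" and t: "t \<in> {0..T}"
  shows "energy N t \<le> (energy N 0 + rate / (real N)\<^sup>2 * t) * exp (10 * rate * t)"
proof -
  let ?p = "\<lambda>\<tau> s. xs N \<tau> (idx N s) - x \<tau> s" and ?q = "\<lambda>\<tau> s. ms N \<tau> (idx N s) - m \<tau> s"
  let ?p' = "\<lambda>\<tau> s. drift N (xs N \<tau>) (ms N \<tau>) (idx N s) - (LINT s'|\<lambda>\<^sub>I. m \<tau> s' * a (x \<tau> s' - x \<tau> s))"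
  let ?q' = "\<lambda>\<tau> s. ms N \<tau> (idx N s) * growth N (xs N \<tau>) (ms N \<tau>) (idx N s) - Psi a \<sigma> s (x \<tau>) (m \<tau>)"
  have pq: "?p \<tau> \<in> Linf_space" "?q \<tau> \<in> Linf_space" "?p' \<tau> \<in> Linf_space" "?q' \<tau> \<in> Linf_space" if \<tau>: "\<tau> \<in> {0..T}" for \<tau>
    using limit_spaces(3,4)[OF \<tau>] limit_spaces(1,2)[OF \<tau>, THEN C_space_imp_Linf_space] idx_in_Linf_space[OF N, of "\<lambda>i. ms N \<tau> i * growth N (xs N \<tau>) (ms N \<tau>) i"]
    by (auto intro!: Linf_space_diff idx_in_Linf_space[OF N])
  show ?thesis
  proof (rule gronwall_affine[OF _ _ _ _ t])
    fix \<tau> assume \<tau>: "\<tau> \<in> {0..T}"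
    interpret cmp: kernel_comparison a "\<sigma>" C S S_inf N "xs N \<tau>" "ms N \<tau>" "x \<tau>" "m \<tau>" K D
      by (rule comparison[OF N \<tau>])
    have "Linf_deriv T ?p (?p' \<tau>) \<tau>"
      by (intro Linf_deriv_diff has_C1_derivative_C_imp_Linf_deriv[OF limit_x_C1 \<tau>] Linf_deriv_idx[OF N] xs_deriv N \<tau>)
    moreover have "Linf_deriv T ?q (?q' \<tau>) \<tau>"
      by (intro Linf_deriv_diff has_C1_derivative_Linf_imp_Linf_deriv[OF limit_m_C1 \<tau>]
          Linf_deriv_idx[OF N, where g = "\<lambda>i. ms N \<tau> i * growth N (xs N \<tau>) (ms N \<tau>) i"] ms_deriv N \<tau>)
    ultimately show "(energy N has_real_derivative
        2 * (LINT s|\<lambda>\<^sub>I. ?p \<tau> s * ?p' \<tau> s) + 2 * (LINT s|\<lambda>\<^sub>I. ?q \<tau> s * ?q' \<tau> s)) (at \<tau> within {0..T})"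
      unfolding energy_def using \<tau> pq
      by (intro DERIV_add has_real_derivative_integral_square) auto
    have "2 * (LINT s|\<lambda>\<^sub>I. ?p \<tau> s * ?p' \<tau> s) + 2 * (LINT s|\<lambda>\<^sub>I. ?q \<tau> s * ?q' \<tau> s)
      = 2 * (LINT s|\<lambda>\<^sub>I. ?p \<tau> s * ?p' \<tau> s + ?q \<tau> s * ?q' \<tau> s)"
      using integrable_mult_Linf[OF pq(1,3)[OF \<tau>]] integrable_mult_Linf[OF pq(2,4)[OF \<tau>]]
      by (subst Bochner_Integration.integral_add) simp_all
    \<comment> \<open>The finite sums are read as the limit vector field evaluated at step
      functions, which brings the derivative into the form of \<open>energy_rate_le\<close>.\<close>
    also have "\<dots> = 2 * (LINT s|\<lambda>\<^sub>I. ?p \<tau> s * ((LINT s'|\<lambda>\<^sub>I. ms N \<tau> (idx N s') * a (xs N \<tau> (idx N s') - xs N \<tau> (idx N s)))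
        - (LINT s'|\<lambda>\<^sub>I. m \<tau> s' * a (x \<tau> s' - x \<tau> s)))
      + ?q \<tau> s * (Psi a \<sigma> s (\<lambda>s. xs N \<tau> (idx N s)) (\<lambda>s. ms N \<tau> (idx N s)) - Psi a \<sigma> s (x \<tau>) (m \<tau>)))"
      by (intro arg_cong2[where f = "(*)"] refl Bochner_Integration.integral_cong) (simp add: drift_idx[OF N] Psi_idx[OF N])
    also have "\<dots> \<le> 10 * rate * cmp.energy + rate / (real N)\<^sup>2"
      unfolding rate_def by (rule cmp.energy_rate_le)
    also have "cmp.energy = energy N \<tau>"
      unfolding cmp.energy_def energy_def power2_eq_square
      using integrable_mult_Linf[OF pq(1,1)[OF \<tau>]] integrable_mult_Linf[OF pq(2,2)[OF \<tau>]]
      by (rule Bochner_Integration.integral_add)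
    finally show "2 * (LINT s|\<lambda>\<^sub>I. ?p \<tau> s * ?p' \<tau> s) + 2 * (LINT s|\<lambda>\<^sub>I. ?q \<tau> s * ?q' \<tau> s)
      \<le> 10 * rate * energy N \<tau> + rate / (real N)\<^sup>2" .
  qed (use rate_nonneg in auto)
qed

end

section \<open>Passage to the limit\<close>

lemma energy_initial_tendsto: "(\<lambda>N. energy N 0) \<longlonglongrightarrow> 0"
proof (rule Lim_transform_eventually)
  have 0: "0 \<in> {0..T}" using T_pos by simp
  have x0_measurable: "x0 \<in> borel_measurable \<lambda>\<^sub>I"
    using x0_continuous by (rule continuous_on_unit_measurable)
  have "(\<lambda>N. LINT s|\<lambda>\<^sub>I. (cell_avg N (idx N s) x0 - x0 s)\<^sup>2) \<longlonglongrightarrow> 0"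
    using x0_bounded by (intro cell_avg_tendsto_L2[where B = X] x0_measurable AE_I2) simp
  from tendsto_add[OF this cell_avg_tendsto_L2[OF m0_measurable m0_bounded]]
  show "(\<lambda>N. (LINT s|\<lambda>\<^sub>I. (cell_avg N (idx N s) x0 - x0 s)\<^sup>2)
      + (LINT s|\<lambda>\<^sub>I. (cell_avg N (idx N s) m0 - m0 s)\<^sup>2)) \<longlonglongrightarrow> 0" by simp
  show "\<forall>\<^sub>F N in sequentially. (LINT s|\<lambda>\<^sub>I. (cell_avg N (idx N s) x0 - x0 s)\<^sup>2)
      + (LINT s|\<lambda>\<^sub>I. (cell_avg N (idx N s) m0 - m0 s)\<^sup>2) = energy N 0"
    using eventually_ge_at_top[of 1]
  proof eventually_elim
    case (elim N)
    note init = initial_values[OF elim idx_in_range[OF elim]]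
    note [measurable] = limit_measurable[OF 0] m0_measurable
    have "(LINT s|\<lambda>\<^sub>I. (cell_avg N (idx N s) x0 - x0 s)\<^sup>2) = (LINT s|\<lambda>\<^sub>I. (xs N 0 (idx N s) - x 0 s)\<^sup>2)"
      by (intro Bochner_Integration.integral_cong refl) (simp add: init limit_x_initial)
    moreover have "(LINT s|\<lambda>\<^sub>I. (cell_avg N (idx N s) m0 - m0 s)\<^sup>2) = (LINT s|\<lambda>\<^sub>I. (ms N 0 (idx N s) - m 0 s)\<^sup>2)"
    proof (rule Bochner_Integration.integral_cong_AE)
      show "AE s in \<lambda>\<^sub>I. (cell_avg N (idx N s) m0 - m0 s)\<^sup>2 = (ms N 0 (idx N s) - m 0 s)\<^sup>2"
        using limit_m_initial AE_space by eventually_elim (simp add: init)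
    qed measurable
    ultimately show ?case by (simp add: energy_def)
  qed
qed

text \<open>Replacing \<open>step_fun\<close> by \<open>idx\<close> changes only a null set. Square
  integrability has to be carried along, since otherwise \<open>L2_norm\<close> takes the value
  infinity.\<close>

lemma L2_norm_step_fun_diff:
  assumes N: "1 \<le> N" and f: "f \<in> Linf_space"
  shows "L2_norm (\<lambda>s. step_fun N v s - f s) = ereal (sqrt (LINT s|\<lambda>\<^sub>I. (v (idx N s) - f s)\<^sup>2))"
proof -
  have f' [measurable]: "f \<in> borel_measurable \<lambda>\<^sub>I" using f by (simp add: Linf_space_def)
  have AE: "AE s in \<lambda>\<^sub>I. (v (idx N s) - f s)\<^sup>2 = (step_fun N v s - f s)\<^sup>2"
    using AE_step_fun_eq[OF N] by eventually_elim simp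
  have "(\<lambda>s. v (idx N s) - f s) \<in> Linf_space"
    by (intro Linf_space_diff idx_in_Linf_space N f)
  from integrable_mult_Linf[OF this this] have "integrable \<lambda>\<^sub>I (\<lambda>s. (v (idx N s) - f s)\<^sup>2)"
    by (simp add: power2_eq_square)
  then have "integrable \<lambda>\<^sub>I (\<lambda>s. (step_fun N v s - f s)\<^sup>2)"
    by (rule integrable_cong_AE_imp) (use AE in \<open>auto elim: eventually_mono\<close>)
  moreover have "(LINT s|\<lambda>\<^sub>I. (v (idx N s) - f s)\<^sup>2) = (LINT s|\<lambda>\<^sub>I. (step_fun N v s - f s)\<^sup>2)"
    using AE by (intro Bochner_Integration.integral_cong_AE) auto
  ultimately show ?thesis by (simp add: L2_norm_def)
qed

lemma C_L2_norm_sum_tendsto: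
  "(\<lambda>N. C_L2_norm T (\<lambda>t s. step_fun N (xs N t) s - x t s) + C_L2_norm T (\<lambda>t s. step_fun N (ms N t) s - m t s)) \<longlonglongrightarrow> 0"
proof -
  obtain B where B: "\<And>t. t \<in> {0..T} \<Longrightarrow> AE s in \<lambda>\<^sub>I. \<bar>m t s\<bar> \<le> B"
    using has_C1_derivative_Linf_imp_bounded[OF limit_m_C1] by blast
  define R where "R = rate B"
  have R: "0 \<le> R" unfolding R_def by (rule rate_nonneg[OF B])
  \<comment> \<open>The bound of \<open>energy_le\<close> increases with \<open>t\<close>; taking
    \<open>T\<close> for \<open>t\<close> in both places makes it uniform in time.\<close>
  define b where "b N = (energy N 0 + R / (real N)\<^sup>2 * T) * exp (10 * R * T)" for N
  have "b \<longlonglongrightarrow> (0 + 0 * T) * exp (10 * R * T)"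
    unfolding b_def by (intro tendsto_intros energy_initial_tendsto) real_asymp
  then have "(\<lambda>N. 2 * sqrt (b N)) \<longlonglongrightarrow> 2 * sqrt ((0 + 0 * T) * exp (10 * R * T))"
    by (intro tendsto_intros)
  then have lim: "(\<lambda>N. ereal (2 * sqrt (b N))) \<longlonglongrightarrow> 0"
    by (simp add: zero_ereal_def)
  have energy_b: "energy N t \<le> b N" if N: "1 \<le> N" and t: "t \<in> {0..T}" for N t
  proof -
    have nonneg: "0 \<le> energy N 0"
      unfolding energy_def by (intro add_nonneg_nonneg Bochner_Integration.integral_nonneg) auto
    have "energy N t \<le> (energy N 0 + R / (real N)\<^sup>2 * t) * exp (10 * R * t)"
      unfolding R_def by (rule energy_le[OF B N t])
    also have "\<dots> \<le> b N"
      unfolding b_def using R t nonneg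
      by (intro mult_mono add_left_mono mult_left_mono) (auto intro: mult_left_mono)
    finally show ?thesis .
  qed
  have bound: "C_L2_norm T (\<lambda>t s. step_fun N (xs N t) s - x t s) \<le> ereal (sqrt (b N))"
    "C_L2_norm T (\<lambda>t s. step_fun N (ms N t) s - m t s) \<le> ereal (sqrt (b N))" if N: "1 \<le> N" for N
  proof -
    have "(LINT s|\<lambda>\<^sub>I. (xs N t (idx N s) - x t s)\<^sup>2) \<le> b N" "(LINT s|\<lambda>\<^sub>I. (ms N t (idx N s) - m t s)\<^sup>2) \<le> b N"
      if "t \<in> {0..T}" for t
    proof -
      have "0 \<le> (LINT s|\<lambda>\<^sub>I. (xs N t (idx N s) - x t s)\<^sup>2)" "0 \<le> (LINT s|\<lambda>\<^sub>I. (ms N t (idx N s) - m t s)\<^sup>2)"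
        by (intro Bochner_Integration.integral_nonneg; simp)+
      with energy_b[OF N that] show "(LINT s|\<lambda>\<^sub>I. (xs N t (idx N s) - x t s)\<^sup>2) \<le> b N" "(LINT s|\<lambda>\<^sub>I. (ms N t (idx N s) - m t s)\<^sup>2) \<le> b N"
        unfolding energy_def by linarith+
    qed
    then show "C_L2_norm T (\<lambda>t s. step_fun N (xs N t) s - x t s) \<le> ereal (sqrt (b N))"
      "C_L2_norm T (\<lambda>t s. step_fun N (ms N t) s - m t s) \<le> ereal (sqrt (b N))"
      unfolding C_L2_norm_def
      by (auto intro!: SUP_least simp: L2_norm_step_fun_diff[OF N] limit_spaces C_space_imp_Linf_space)
  qed
  \<comment> \<open>The supremum needs a time to be taken over: the empty supremum of extended reals
    is negative infinity. Time 0 is available as \<open>0 < T\<close>.\<close>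
  have nonneg: "0 \<le> C_L2_norm T u" for u
  proof -
    have "0 \<le> L2_norm (u 0)"
      by (simp add: L2_norm_def Bochner_Integration.integral_nonneg)
    also have "\<dots> \<le> C_L2_norm T u"
      unfolding C_L2_norm_def using T_pos by (intro SUP_upper) simp
    finally show ?thesis .
  qed
  show ?thesis
  proof (rule tendsto_sandwich[OF _ _ tendsto_const lim])
    show "\<forall>\<^sub>F N in sequentially. 0 \<le> C_L2_norm T (\<lambda>t s. step_fun N (xs N t) s - x t s)
        + C_L2_norm T (\<lambda>t s. step_fun N (ms N t) s - m t s)"
      by (simp add: nonneg)
    show "\<forall>\<^sub>F N in sequentially. C_L2_norm T (\<lambda>t s. step_fun N (xs N t) s - x t s)
        + C_L2_norm T (\<lambda>t s. step_fun N (ms N t) s - m t s) \<le> ereal (2 * sqrt (b N))"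
      using eventually_ge_at_top[of 1]
    proof eventually_elim
      case (elim N)
      from add_mono[OF bound[OF elim]] show ?case by simp
    qed
  qed
qed

end

theorem theorem4p1:
  fixes a \<sigma> x0 m0 :: "real \<Rightarrow> real"
    and L M X S_inf S T :: real
    and x m :: "real \<Rightarrow> real \<Rightarrow> real"
    and xs ms :: "nat \<Rightarrow> real \<Rightarrow> nat \<Rightarrow> real"
  assumes "T > 0"
    and H1_lipschitz: "\<exists>C. C-lipschitz_on UNIV a" "Lip a = L"
    and H1_zero: "a 0 = 0"
    and H2_m0: "m0 \<in> Linf_space" "(LINT s|\<lambda>\<^sub>I. m0 s) = 1"
    and H2_M: "M > 1" "AE s in \<lambda>\<^sub>I. 1 / M \<le> m0 s \<and> m0 s \<le> M"
    and H2_x0: "continuous_on \<I> x0" "inj_on x0 \<I>"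
    and H2_X: "X > 0" "\<forall>s\<in>\<I>. \<bar>x0 s\<bar> \<le> X"
    and H3_odd: "\<forall>y. \<sigma> (- y) = - \<sigma> y"
    and H3_bounded: "S_inf > 0" "\<forall>y. \<bar>\<sigma> y\<bar> \<le> S_inf"
    and H3_lipschitz: "S > 0"
      "\<forall>y1\<in>{0<..}. \<forall>y2\<in>{0<..}. \<bar>\<sigma> y1 - \<sigma> y2\<bar> \<le> S * \<bar>y1 - y2\<bar>"
      "\<forall>y1\<in>{..<0}. \<forall>y2\<in>{..<0}. \<bar>\<sigma> y1 - \<sigma> y2\<bar> \<le> S * \<bar>y1 - y2\<bar>"
    and limit_solution: "graph_limit_solution a \<sigma> x0 m0 T x m"
    and N_solution: "\<And>N. N \<ge> 1 \<Longrightarrow> opinion_system_solution a \<sigma> x0 m0 T N (xs N) (ms N)"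
  shows "(\<lambda>N. C_L2_norm T (\<lambda>t s. step_fun N (xs N t) s - x t s)
            + C_L2_norm T (\<lambda>t s. step_fun N (ms N t) s - m t s)) \<longlonglongrightarrow> 0"
proof -
  obtain C where "C-lipschitz_on UNIV a" using H1_lipschitz(1) by blast
  then have C: "\<bar>a u - a v\<bar> \<le> C * \<bar>u - v\<bar>" for u v
    by (auto simp: lipschitz_on_def dist_real_def)
  interpret mean_field_limit a "\<sigma>" C S S_inf x0 m0 X M T x m xs ms
    using assms C by unfold_locales (auto simp: Linf_space_def)
  show ?thesis by (rule C_L2_norm_sum_tendsto)
qed

end
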